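(* Let $A\in\mathbb{R}^{n\times n}$, $B\in\mathbb{R}^{n\times m}$, $H\in\mathbb{R}^{n\times d}$ with $(A,B)$ stabilizable and $H$ of full row rank; let $Q\succ0$, $R\succ0$, $Q^c\succeq0$. Let $\mathbb{P}_w$ be a zero-mean probability measure on $\mathbb{R}^d$, non-singular with respect to Lebesgue measure, with a non-trivial density, covariance $\Sigma_W\succ0$ and finite fourth moment. Let $\bar\beta\in\mathbb{R}$ be such that there exists $K\in\mathcal{S}$ with $\gamma_N^2(K)<\bar\beta$ (Slater's condition). Consider, for $K\in\mathcal{S}$ and $\lambda\ge0$, the Lagrangian $$L(K,\lambda)=\mathrm{tr}[Q_K\Sigma_K]+\lambda\big(\gamma_N^2(K)-\bar\beta\big).$$ Then strong duality holds for $\sup_{\lambda\ge0}\min_{K\in\mathcal{S}}L(K,\lambda)$, with a unique solution $(K^*(\lambda^* ),\lambda^* )$; i.e. both the primal and dual problems are feasible with identical values: $$\max_{\lambda\ge0}\min_{K\in\mathcal{S}}L(K,\lambda)=L(K^*(\lambda^* ),\lambda^* )=\min_{K\in\mathcal{S}}\max_{\lambda\ge0}L(K,\lambda).$$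
   Context: $A_K:=A+BK$, $Q_K:=Q+K^\intercal RK$, $\mathcal{S}:=\{K\in\mathbb{R}^{m\times n}:A_K\text{ has spectral radius}<1\}$. For $K\in\mathcal{S}$, $\Sigma_K$ is the unique positive definite solution of $\Sigma_K=A_K\Sigma_KA_K^\intercal+H\Sigma_WH^\intercal$, and $$\gamma_N^2(K):=4\,\mathrm{tr}[Q^cH\Sigma_WH^\intercal Q^c(\Sigma_K-H\Sigma_WH^\intercal)]+m_4(Q^c),\quad m_4(Q^c):=\mathbb{E}\big[\mathrm{tr}[Q^cH(WW^\intercal-\Sigma_W)H^\intercal]^2\big],\ W\sim\mathbb{P}_w.$$ The primal problem is: minimize $\mathrm{tr}[Q_K\Sigma_K]$ over $K\in\mathcal{S}$ subject to $\gamma_N^2(K)\le\bar\beta$. For each $\lambda\ge0$, $K^*(\lambda):=\arg\min_{K\in\mathcal{S}}L(K,\lambda)$, which exists and is unique. The inner $\max_{\lambda\geq 0}$ is $+\infty$ when $K$ is infeasible. *)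

theory Defs
  imports "HOL-Probability.Probability"
begin

section \<open>Matrices\<close>

definition pos_def :: "real^'n^'n \<Rightarrow> bool" where
  "pos_def M \<longleftrightarrow> transpose M = M \<and> (\<forall>x. x \<noteq> 0 \<longrightarrow> x \<bullet> (M *v x) > 0)"

definition pos_semidef :: "real^'n^'n \<Rightarrow> bool" where
  "pos_semidef M \<longleftrightarrow> transpose M = M \<and> (\<forall>x. x \<bullet> (M *v x) \<ge> 0)"

definition full_row_rank :: "real^'d^'n \<Rightarrow> bool" where
  "full_row_rank M \<longleftrightarrow> rank M = CARD('n)"

text \<open>The spectrum of a real matrix consists of its complex eigenvalues. It is finite and
  nonempty, so the maximum below is attained.\<close>

definition complex_spectrum :: "real^'n^'n \<Rightarrow> complex set" where
  "complex_spectrum M = {z. \<exists>v. v \<noteq> 0 \<and> map_matrix complex_of_real M *v v = z *s v}"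

definition spec_radius :: "real^'n^'n \<Rightarrow> real" where
  "spec_radius M = Max (norm ` complex_spectrum M)"

definition outer_prod :: "real^'d \<Rightarrow> real^'d^'d" where
  "outer_prod w = (columnvector w :: real^1^'d) ** (rowvector w :: real^'d^1)"


section \<open>Noise distribution\<close>

definition zero_mean :: "(real^'d) measure \<Rightarrow> bool" where
  "zero_mean P \<longleftrightarrow> integrable P (\<lambda>w. w) \<and> (\<integral>w. w \<partial>P) = 0"

definition finite_fourth_moment :: "(real^'d) measure \<Rightarrow> bool" where
  "finite_fourth_moment P \<longleftrightarrow> integrable P (\<lambda>w. norm w ^ 4)"

definition cov_mat :: "(real^'d) measure \<Rightarrow> real^'d^'d" where
  "cov_mat P = (let \<mu> = (\<integral>w. w \<partial>P) in
     (\<chi> i j. \<integral>w. (w $ i - \<mu> $ i) * (w $ j - \<mu> $ j) \<partial>P))"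

definition mutually_singular :: "'a::topological_space measure \<Rightarrow> 'a measure \<Rightarrow> bool" where
  "mutually_singular M N \<longleftrightarrow>
     (\<exists>S\<in>sets borel. emeasure M S = 0 \<and> emeasure N (- S) = 0)"

text \<open>``Non-singular with a non-trivial density'' is understood as in the theory of Markov chains
  (Meyn and Tweedie): \<open>f\<close> is the density of the absolutely continuous part in the Lebesgue
  decomposition of \<open>P\<close>, and is not almost everywhere zero. A singular part \<open>\<nu>\<close> may be present;
  distributions having a density are the case \<open>\<nu> = 0\<close>.\<close>

definition nontrivial_lebesgue_density :: "(real^'d) measure \<Rightarrow> bool" where
  "nontrivial_lebesgue_density P \<longleftrightarrow>
     (\<exists>f \<nu>. f \<in> borel_measurable borel \<and> sets \<nu> = sets borel \<and> mutually_singular \<nu> lborel \<and>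
        (\<forall>S\<in>sets borel. emeasure P S = emeasure (density lborel f) S + emeasure \<nu> S) \<and>
        \<not> (AE w in lborel. f w = 0))"


section \<open>Linear quadratic regulator with risk constraint\<close>

definition closed_loop :: "real^'n^'n \<Rightarrow> real^'m^'n \<Rightarrow> real^'n^'m \<Rightarrow> real^'n^'n" where
  "closed_loop A B K = A + B ** K"

definition closed_loop_cost ::
    "real^'n^'n \<Rightarrow> real^'m^'m \<Rightarrow> real^'n^'m \<Rightarrow> real^'n^'n" where
  "closed_loop_cost Q R K = Q + transpose K ** R ** K"

definition stab_gains :: "real^'n^'n \<Rightarrow> real^'m^'n \<Rightarrow> (real^'n^'m) set" where
  "stab_gains A B = {K. spec_radius (closed_loop A B K) < 1}"

definition stabilizable :: "real^'n^'n \<Rightarrow> real^'m^'n \<Rightarrow> bool" where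
  "stabilizable A B \<longleftrightarrow> stab_gains A B \<noteq> {}"

definition noise_cov :: "real^'d^'n \<Rightarrow> (real^'d) measure \<Rightarrow> real^'n^'n" where
  "noise_cov H P = H ** cov_mat P ** transpose H"

definition stationary_cov ::
    "real^'n^'n \<Rightarrow> real^'m^'n \<Rightarrow> real^'d^'n \<Rightarrow> (real^'d) measure \<Rightarrow> real^'n^'m \<Rightarrow> real^'n^'n" where
  "stationary_cov A B H P K =
     (THE S. pos_def S \<and>
        S = closed_loop A B K ** S ** transpose (closed_loop A B K) + noise_cov H P)"

definition fourth_moment_term ::
    "real^'d^'n \<Rightarrow> (real^'d) measure \<Rightarrow> real^'n^'n \<Rightarrow> real" where
  "fourth_moment_term H P Qc =
     (\<integral>w. (trace (Qc ** H ** (outer_prod w - cov_mat P) ** transpose H))\<^sup>2 \<partial>P)"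

definition risk ::
    "real^'n^'n \<Rightarrow> real^'m^'n \<Rightarrow> real^'d^'n \<Rightarrow> (real^'d) measure \<Rightarrow> real^'n^'n \<Rightarrow>
     real^'n^'m \<Rightarrow> real" where
  "risk A B H P Qc K =
     4 * trace (Qc ** noise_cov H P ** Qc ** (stationary_cov A B H P K - noise_cov H P))
     + fourth_moment_term H P Qc"

definition lqr_cost ::
    "real^'n^'n \<Rightarrow> real^'m^'n \<Rightarrow> real^'d^'n \<Rightarrow> (real^'d) measure \<Rightarrow> real^'n^'n \<Rightarrow> real^'m^'m \<Rightarrow>
     real^'n^'m \<Rightarrow> real" where
  "lqr_cost A B H P Q R K = trace (closed_loop_cost Q R K ** stationary_cov A B H P K)"

definition primal_feasible ::
    "real^'n^'n \<Rightarrow> real^'m^'n \<Rightarrow> real^'d^'n \<Rightarrow> (real^'d) measure \<Rightarrow> real^'n^'n \<Rightarrow> real \<Rightarrow>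
     real^'n^'m \<Rightarrow> bool" where
  "primal_feasible A B H P Qc \<beta> K \<longleftrightarrow> K \<in> stab_gains A B \<and> risk A B H P Qc K \<le> \<beta>"

definition lagrangian ::
    "real^'n^'n \<Rightarrow> real^'m^'n \<Rightarrow> real^'d^'n \<Rightarrow> (real^'d) measure \<Rightarrow>
     real^'n^'n \<Rightarrow> real^'m^'m \<Rightarrow> real^'n^'n \<Rightarrow> real \<Rightarrow> real^'n^'m \<Rightarrow> real \<Rightarrow> real" where
  "lagrangian A B H P Q R Qc \<beta> K l =
     lqr_cost A B H P Q R K + l * (risk A B H P Qc K - \<beta>)"

definition opt_gain ::
    "real^'n^'n \<Rightarrow> real^'m^'n \<Rightarrow> real^'d^'n \<Rightarrow> (real^'d) measure \<Rightarrow>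
     real^'n^'n \<Rightarrow> real^'m^'m \<Rightarrow> real^'n^'n \<Rightarrow> real \<Rightarrow> real \<Rightarrow> real^'n^'m" where
  "opt_gain A B H P Q R Qc \<beta> l =
     arg_min (\<lambda>K. lagrangian A B H P Q R Qc \<beta> K l) (\<lambda>K. K \<in> stab_gains A B)"

text \<open>The inner optimal values live in the extended reals: \<open>max_fun\<close> is \<open>\<infinity>\<close> exactly at the
  infeasible gains.\<close>

definition dual_fun ::
    "real^'n^'n \<Rightarrow> real^'m^'n \<Rightarrow> real^'d^'n \<Rightarrow> (real^'d) measure \<Rightarrow>
     real^'n^'n \<Rightarrow> real^'m^'m \<Rightarrow> real^'n^'n \<Rightarrow> real \<Rightarrow> real \<Rightarrow> ereal" where
  "dual_fun A B H P Q R Qc \<beta> l =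
     (INF K\<in>stab_gains A B. ereal (lagrangian A B H P Q R Qc \<beta> K l))"

definition max_fun ::
    "real^'n^'n \<Rightarrow> real^'m^'n \<Rightarrow> real^'d^'n \<Rightarrow> (real^'d) measure \<Rightarrow>
     real^'n^'n \<Rightarrow> real^'m^'m \<Rightarrow> real^'n^'n \<Rightarrow> real \<Rightarrow> real^'n^'m \<Rightarrow> ereal" where
  "max_fun A B H P Q R Qc \<beta> K =
     (SUP l\<in>{0..}. ereal (lagrangian A B H P Q R Qc \<beta> K l))"

lemma max_fun_eq:
  "max_fun A B H P Q R Qc \<beta> K =
     (if risk A B H P Qc K \<le> \<beta> then ereal (lqr_cost A B H P Q R K) else \<infinity>)"
proof (cases "risk A B H P Qc K \<le> \<beta>")
  case True
  have "(SUP l\<in>{0..}. ereal (lagrangian A B H P Q R Qc \<beta> K l)) = ereal (lqr_cost A B H P Q R K)"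
  proof (rule antisym)
    show "(SUP l\<in>{0..}. ereal (lagrangian A B H P Q R Qc \<beta> K l)) \<le> ereal (lqr_cost A B H P Q R K)"
      using True by (intro SUP_least) (auto simp: lagrangian_def mult_nonneg_nonpos)
    show "ereal (lqr_cost A B H P Q R K) \<le> (SUP l\<in>{0..}. ereal (lagrangian A B H P Q R Qc \<beta> K l))"
      by (rule SUP_upper2[of 0]) (auto simp: lagrangian_def)
  qed
  then show ?thesis using True by (simp add: max_fun_def)
next
  case False
  define g where "g = risk A B H P Qc K - \<beta>"
  have g: "g > 0" using False by (simp add: g_def)
  have "\<exists>l\<in>{0..}. ereal (real n) \<le> ereal (lagrangian A B H P Q R Qc \<beta> K l)" for n
  proof
    let ?l = "(real n + \<bar>lqr_cost A B H P Q R K\<bar>) / g"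
    show "?l \<in> {0..}" using g by simp
    show "ereal (real n) \<le> ereal (lagrangian A B H P Q R Qc \<beta> K ?l)"
      using g by (simp add: lagrangian_def flip: g_def)
  qed
  then have "(SUP l\<in>{0..}. ereal (lagrangian A B H P Q R Qc \<beta> K l)) = \<infinity>"
    by (rule SUP_PInfty)
  then show ?thesis using False by (simp add: max_fun_def)
qed

end

theory Submission
  imports Defs "HOL-Computational_Algebra.Fundamental_Theorem_Algebra"
begin

text \<open>With \<open>C = 4 Q\<^sup>c W Q\<^sup>c\<close>, where \<open>W\<close> is the covariance of \<open>H w\<close>, the Lagrangian is, up to a constant,
  the LQR cost with state weight \<open>Q + \<lambda> C\<close>. A completion of the square shows that a
  gain with vanishing gradient is its unique minimizer, and conversely a nonzero gradient yields a
  descent step. Minimizers exist because sublevel sets are compact: a bound on the cost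
  bounds both \<open>K\<close> and \<open>\<Sigma>\<^sub>K\<close>, and a limit \<open>\<Sigma> \<ge> W > 0\<close> of such covariances certifies
  that the limit gain is stabilizing. The same compactness makes the constraint value at the
  minimizer continuous in \<open>\<lambda>\<close>, and Slater's condition makes it negative for large \<open>\<lambda>\<close>, so an
  intermediate value argument gives a multiplier with complementary slackness, that is, a saddle
  point. If a second multiplier were optimal, the same gain would minimize the Lagrangian for both;
  its gradient for the weight \<open>C\<close> alone then vanishes, so it minimizes the risk itself and has
  risk \<open>\<beta>\<close>, against Slater's condition.\<close>

section \<open>Matrices\<close>

text \<open>In general neither the set of stabilizing gains nor the Lagrangian on it is convex, so
  duality cannot be read off from a separation argument. Uniqueness of the minimizer takes the place
  of convexity: it makes the constraint value a function of \<lambda>, whose continuity the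
  intermediate value argument needs. The weight \<open>C\<close> is only semidefinite and comes
  without a control cost, so the theory of minimizers, which rests on \<open>R\<close>, does not
  apply to it directly; it enters as the difference of two weights \<open>Q + \<lambda> C\<close>,
  for which the control costs cancel. Stability is given by complex eigenvalues but used through
  real Lyapunov equations. The link is the decay of matrix powers; after it, a positive definite
  solution serves as the certificate of stability.\<close>

primrec mpow :: "'a::semiring_1^'n^'n \<Rightarrow> nat \<Rightarrow> 'a^'n^'n" where
  "mpow A 0 = mat 1"
| "mpow A (Suc k) = A ** mpow A k"

lemma mpow_commute: "mpow A k ** A = A ** mpow A k"
  by (induction k) (simp_all add: matrix_mul_assoc[symmetric])

lemma transpose_mpow: "transpose (mpow A k) = mpow (transpose (A :: 'a::comm_semiring_1^'n^'n)) k"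
  by (induction k) (simp_all add: matrix_transpose_mul mpow_commute)

lemma map_matrix_of_real_mult:
  "map_matrix of_real (A ** B) = (map_matrix of_real A ** map_matrix of_real B :: complex^'k^'n)"
  for A :: "real^'m^'n"
  by (simp add: vec_eq_iff matrix_matrix_mult_def)

lemma map_matrix_of_real_mpow:
  "map_matrix of_real (mpow A k) = mpow (map_matrix of_real A :: complex^'n^'n) k"
proof (induction k)
  case 0
  show ?case by (simp add: vec_eq_iff mat_def)
qed (simp add: map_matrix_of_real_mult)

lemma bounded_bilinear_matrix_mult:
  "bounded_bilinear ((**) :: real^'m^'n \<Rightarrow> real^'k^'m \<Rightarrow> real^'k^'n)"
proof -
  have "bilinear ((**) :: real^'m^'n \<Rightarrow> real^'k^'m \<Rightarrow> real^'k^'n)"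
    unfolding bilinear_def
    by (auto intro!: linearI simp: vec_eq_iff matrix_matrix_mult_def algebra_simps sum.distrib sum_distrib_left)
  then show ?thesis by (simp add: bilinear_conv_bounded_bilinear)
qed

lemmas tendsto_matrix_mult [tendsto_intros] = bounded_bilinear.tendsto[OF bounded_bilinear_matrix_mult]

lemma bounded_bilinear_matrix_vector_mult:
  "bounded_bilinear ((*v) :: real^'m^'n \<Rightarrow> real^'m \<Rightarrow> real^'n)"
proof -
  have "bilinear ((*v) :: real^'m^'n \<Rightarrow> real^'m \<Rightarrow> real^'n)"
    unfolding bilinear_def
    by (auto intro!: linearI simp: vec_eq_iff matrix_vector_mult_def algebra_simps sum.distrib sum_distrib_left)
  then show ?thesis by (simp add: bilinear_conv_bounded_bilinear)
qed

lemmas tendsto_matrix_vector_mult [tendsto_intros] =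
  bounded_bilinear.tendsto[OF bounded_bilinear_matrix_vector_mult]

lemma tendsto_transpose [tendsto_intros]:
  "(f \<longlongrightarrow> M) F \<Longrightarrow> ((\<lambda>x. transpose (f x :: real^'m^'n)) \<longlongrightarrow> transpose M) F"
  unfolding transpose_def by (intro vec_tendstoI) (simp add: tendsto_vec_nth)

lemma tendsto_trace [tendsto_intros]:
  "(f \<longlongrightarrow> M) F \<Longrightarrow> ((\<lambda>x. trace (f x :: real^'n^'n)) \<longlongrightarrow> trace M) F"
  unfolding trace_def by (intro tendsto_sum) (simp add: tendsto_vec_nth)

lemma matrix_tendsto_0I:
  assumes "\<And>x. (\<lambda>k. M k *v x) \<longlonglongrightarrow> 0"
  shows "(\<lambda>k. M k :: real^'m^'n) \<longlonglongrightarrow> 0"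
proof (intro vec_tendstoI)
  fix i j
  have "(\<lambda>k. (M k *v axis j 1) $ i) \<longlonglongrightarrow> 0 $ i"
    using assms by (rule tendsto_vec_nth)
  then show "(\<lambda>k. M k $ i $ j) \<longlonglongrightarrow> 0 $ i $ j"
    by (simp add: matrix_vector_mult_basis column_def)
qed

section \<open>Spectral radius and decay of powers\<close>

text \<open>The matrix \<open>p(T)\<close> applied to a vector. The vector is an argument because
  the induction on linear factors moves each factor onto it.\<close>

definition poly_at :: "'a::comm_ring_1^'n^'n \<Rightarrow> 'a poly \<Rightarrow> 'a^'n \<Rightarrow> 'a^'n" where
  "poly_at T p x = (\<Sum>i\<le>degree p. coeff p i *s (mpow T i *v x))"

lemma poly_at_eq: "degree p \<le> N \<Longrightarrow> poly_at T p x = (\<Sum>i\<le>N. coeff p i *s (mpow T i *v x))"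
  unfolding poly_at_def
  by (rule sum.mono_neutral_left) (auto simp: coeff_eq_0)

lemma matrix_vector_mult_smult: "T *v (c *s x) = c *s (T *v x)" for T :: "'a::comm_semiring_1^'m^'n"
  by (simp add: vec_eq_iff matrix_vector_mult_def sum_distrib_left ac_simps)

lemma mat_mult_vec: "mat z *v w = z *s w"
  by (simp add: vec_eq_iff matrix_vector_mult_def mat_def mult_delta_left)

text \<open>\<open>T\<close> commutes with its powers, so the factor \<open>T - z\<close> of
  \<open>p(T)\<close> may act on the vector first. Multiplication by the variable is the index shift
  \<open>pCons 0 q\<close>.\<close>

lemma poly_at_linear_factor:
  "poly_at T ([:- z, 1:] * q) x = poly_at T q (T *v x - z *s x)"
proof -
  define N where "N = Suc (degree q)"
  have "degree ([:- z, 1:] * q) \<le> N"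
    using degree_mult_le[of "[:- z, 1:]" q] by (simp add: N_def degree_pCons_eq_if split: if_splits)
  then have "poly_at T ([:- z, 1:] * q) x = (\<Sum>i\<le>N. coeff ([:- z, 1:] * q) i *s (mpow T i *v x))"
    by (rule poly_at_eq)
  also have "\<dots> = (\<Sum>i\<le>N. coeff (pCons 0 q) i *s (mpow T i *v x))
      - (\<Sum>i\<le>N. (z * coeff q i) *s (mpow T i *v x))"
    by (simp add: sum_subtractf[symmetric] vec.scale_left_diff_distrib[symmetric] algebra_simps)
  also have "(\<Sum>i\<le>N. coeff (pCons 0 q) i *s (mpow T i *v x))
      = (\<Sum>i\<le>degree q. coeff q i *s (mpow T i *v (T *v x)))"
    unfolding N_def by (subst sum.atMost_Suc_shift) (simp add: matrix_vector_mul_assoc mpow_commute)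
  also have "(\<Sum>i\<le>N. (z * coeff q i) *s (mpow T i *v x))
      = (\<Sum>i\<le>degree q. (z * coeff q i) *s (mpow T i *v x))"
    by (rule sum.mono_neutral_right) (auto simp: coeff_eq_0 N_def)
  also have "(\<Sum>i\<le>degree q. coeff q i *s (mpow T i *v (T *v x)))
      - (\<Sum>i\<le>degree q. (z * coeff q i) *s (mpow T i *v x)) = poly_at T q (T *v x - z *s x)"
    unfolding poly_at_def sum_subtractf[symmetric]
    by (rule sum.cong)
      (simp_all add: matrix_vector_mult_diff_distrib matrix_vector_mult_smult
        vector_ssub_ldistrib vector_smult_assoc mult.commute)
  finally show ?thesis .
qed

text \<open>Over the complex numbers \<open>p\<close> splits, and its factors are peeled off one at
  a time; the nonzero constant left at the end forces the vector to be 0. A property that holds at 0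
  and pulls back through every \<open>T - z\<close> therefore holds wherever \<open>p(T)\<close>
  vanishes.\<close>

lemma poly_at_induct:
  fixes T :: "complex^'n^'n"
  assumes "p \<noteq> 0" "poly_at T p x = 0" "Z 0" "\<And>z y. Z (T *v y - z *s y) \<Longrightarrow> Z y"
  shows "Z x"
  using assms(1,2)
proof (induction "degree p" arbitrary: p x)
  case 0
  then show ?case
    using assms(3) by (auto elim!: degree_eq_zeroE simp: poly_at_def)
next
  case (Suc d)
  then have "\<not> constant (poly p)" by (simp add: constant_degree)
  then obtain z where "poly p z = 0" using fundamental_theorem_of_algebra by blast
  then obtain q where q: "p = [:- z, 1:] * q" by (auto simp: poly_eq_0_iff_dvd)
  with Suc.prems have "q \<noteq> 0" by auto
  then have "degree p = Suc (degree q)" unfolding q by (subst degree_mult_eq) auto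
  moreover have "poly_at T q (T *v x - z *s x) = 0"
    using Suc.prems(2) unfolding q poly_at_linear_factor .
  ultimately have "Z (T *v x - z *s x)"
    using \<open>q \<noteq> 0\<close> Suc.hyps by (intro Suc.hyps(1)[of q]) auto
  then show ?case by (rule assms(4))
qed

lemma poly_at_eigenvector:
  assumes "T *v v = z *s v"
  shows "poly_at T p v = poly p z *s v"
proof -
  have "mpow T i *v v = z ^ i *s v" for i
  proof (induction i)
    case (Suc i)
    then show ?case
      by (simp add: matrix_vector_mul_assoc[symmetric] matrix_vector_mult_smult assms mult.commute vector_smult_assoc)
  qed simp
  then have "poly_at T p v = (\<Sum>i\<le>degree p. (coeff p i * z ^ i) *s v)"
    by (simp add: poly_at_def vector_smult_assoc)
  then show ?thesis by (simp add: poly_altdef vec_eq_iff sum_component sum_distrib_right)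
qed

text \<open>Dependence is a property of sets and forgets repetitions, hence the case split: either
  more than \<open>DIM('a)\<close> distinct vectors are dependent, or two equal vectors are
  subtracted.\<close>

lemma nontrivial_relation:
  fixes f :: "nat \<Rightarrow> 'a::euclidean_space"
  shows "\<exists>c N. (\<exists>i\<le>N. c i \<noteq> 0) \<and> (\<Sum>i\<le>N. c i *\<^sub>R f i) = 0"
proof (cases "inj_on f {..DIM('a)}")
  case True
  then have "card (f ` {..DIM('a)}) = Suc (DIM('a))" by (simp add: card_image)
  then have "dependent (f ` {..DIM('a)})" using independent_bound[of "f ` {..DIM('a)}"] by linarith
  then obtain u v where u: "v \<in> f ` {..DIM('a)}" "u v \<noteq> 0" "(\<Sum>w\<in>f ` {..DIM('a)}. u w *\<^sub>R w) = 0"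
    by (auto simp: dependent_finite)
  then have "(\<Sum>i\<le>DIM('a). u (f i) *\<^sub>R f i) = 0" using True by (simp add: sum.reindex)
  with u show ?thesis by (intro exI[of _ "\<lambda>i. u (f i)"] exI[of _ "DIM('a)"]) auto
next
  case False
  then obtain i j where ij: "i \<le> DIM('a)" "j \<le> DIM('a)" "i \<noteq> j" "f i = f j"
    by (auto simp: inj_on_def)
  let ?c = "\<lambda>k. (if k = i then 1 else 0) - (if k = j then 1 else (0::real))"
  have "(\<Sum>k\<le>DIM('a). ?c k *\<^sub>R f k) = (\<Sum>k\<le>DIM('a). if k = i then f i else 0) - (\<Sum>k\<le>DIM('a). if k = j then f j else 0)"
    unfolding sum_subtractf[symmetric] by (rule sum.cong) auto
  also have "\<dots> = 0" using ij by simp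
  finally show ?thesis using ij by (intro exI[of _ ?c] exI[of _ "DIM('a)"]) auto
qed

lemma annihilating_polynomial:
  fixes A :: "real^'n^'n"
  shows "\<exists>p. p \<noteq> 0 \<and> (\<forall>x. poly_at (map_matrix complex_of_real A) p x = 0)"
proof -
  obtain c N where c: "\<exists>i\<le>N. c i \<noteq> 0" "(\<Sum>i\<le>N. c i *\<^sub>R mpow A i) = 0"
    using nontrivial_relation[of "mpow A"] by auto
  define p where "p = (\<Sum>i\<le>N. monom (complex_of_real (c i)) i)"
  have coeff: "coeff p i = (if i \<le> N then of_real (c i) else 0)" for i
    by (simp add: p_def coeff_sum)
  then have "degree p \<le> N" by (simp add: degree_le)
  have "p \<noteq> 0" using c(1) coeff by (metis coeff_0 of_real_eq_0_iff)
  have "(\<Sum>i\<le>N. of_real (c i) * (mpow (map_matrix complex_of_real A) i $ k $ l)) = 0" for k l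
  proof -
    have "of_real ((\<Sum>i\<le>N. c i *\<^sub>R mpow A i) $ k $ l) = (0::complex)" using c(2) by simp
    then show ?thesis
      by (simp add: map_matrix_of_real_mpow[symmetric] sum_component)
  qed
  note eq = this
  have "poly_at (map_matrix complex_of_real A) p x = 0" for x
  proof -
    have "poly_at (map_matrix complex_of_real A) p x $ k = 0" for k
    proof -
      have "poly_at (map_matrix complex_of_real A) p x $ k
        = (\<Sum>i\<le>N. \<Sum>l\<in>UNIV. of_real (c i) * (mpow (map_matrix complex_of_real A) i $ k $ l) * x $ l)"
        by (simp add: poly_at_eq[OF \<open>degree p \<le> N\<close>] coeff sum_component matrix_vector_mult_def sum_distrib_left mult.assoc)
      also have "\<dots> = (\<Sum>l\<in>UNIV. (\<Sum>i\<le>N. of_real (c i) * (mpow (map_matrix complex_of_real A) i $ k $ l)) * x $ l)"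
        by (subst sum.swap) (simp add: sum_distrib_right)
      finally show ?thesis by (simp add: eq)
    qed
    then show ?thesis by (simp add: vec_eq_iff)
  qed
  with \<open>p \<noteq> 0\<close> show ?thesis by blast
qed

text \<open>Eigenvalues are roots of every annihilating polynomial. Together with nonemptiness this
  gives the \<open>Max\<close> in \<open>spec_radius\<close> its meaning.\<close>

lemma finite_complex_spectrum: "finite (complex_spectrum A)"
proof -
  obtain p where p: "p \<noteq> 0" "\<And>x. poly_at (map_matrix complex_of_real A) p x = 0"
    using annihilating_polynomial by blast
  have "complex_spectrum A \<subseteq> {z. poly p z = 0}"
  proof
    fix z assume "z \<in> complex_spectrum A"
    then obtain v where v: "v \<noteq> 0" "map_matrix complex_of_real A *v v = z *s v"
      by (auto simp: complex_spectrum_def)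
    have "poly p z *s v = 0" using p(2)[of v] poly_at_eigenvector[OF v(2), of p] by simp
    then show "z \<in> {z. poly p z = 0}" using v(1) by simp
  qed
  then show ?thesis using poly_roots_finite[OF p(1)] finite_subset by blast
qed

lemma not_in_spectrum:
  assumes "z \<notin> complex_spectrum A" "map_matrix complex_of_real A *v y - z *s y = 0"
  shows "y = 0"
  using assms by (auto simp: complex_spectrum_def)

text \<open>With an empty spectrum every \<open>T - z\<close> would be injective, so being zero
  would pull back through all factors of an annihilating polynomial and reach every vector.\<close>

lemma complex_spectrum_nonempty: "complex_spectrum A \<noteq> {}"
proof
  assume empty: "complex_spectrum A = {}"
  obtain p where p: "p \<noteq> 0" "\<And>x. poly_at (map_matrix complex_of_real A) p x = 0"
    using annihilating_polynomial by blast
  have "x = 0" for x :: "complex^'a"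
    using p(1) p(2)[of x] by (rule poly_at_induct) (use empty not_in_spectrum in auto)
  from this[of "1"] show False by (simp add: vec_eq_iff)
qed

lemma spec_radius_less_iff: "spec_radius A < r \<longleftrightarrow> (\<forall>z\<in>complex_spectrum A. norm z < r)"
  unfolding spec_radius_def
  using finite_complex_spectrum complex_spectrum_nonempty by (subst Max_less_iff) auto

lemma contraction_tendsto_0:
  fixes u e :: "nat \<Rightarrow> real"
  assumes u: "\<And>k. 0 \<le> u k" "\<And>k. u (Suc k) \<le> r * u k + e k" and r: "0 \<le> r" "r < 1"
    and e: "e \<longlonglongrightarrow> 0"
  shows "u \<longlonglongrightarrow> 0"
proof (rule LIMSEQ_I)
  fix \<epsilon> :: real assume "\<epsilon> > 0"
  \<comment> \<open>Half of \<open>\<epsilon>\<close> is for the geometric transient and half for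
    \<open>d\<close>, the fixed point of the map taking t to \<open>r * t + d * (1 - r)\<close>;
    this is why the bound below reproduces itself.\<close>
  define d where "d = \<epsilon> / 2"
  have "d > 0" using \<open>\<epsilon> > 0\<close> by (simp add: d_def)
  have "eventually (\<lambda>k. e k < d * (1 - r)) sequentially"
    using e \<open>d > 0\<close> r by (intro order_tendstoD) auto
  then obtain N where N: "\<And>k. k \<ge> N \<Longrightarrow> e k < d * (1 - r)" by (auto simp: eventually_sequentially)
  have bound: "u (N + j) \<le> r ^ j * u N + d" for j
  proof (induction j)
    case (Suc j)
    have "u (N + Suc j) \<le> r * u (N + j) + e (N + j)" using u(2)[of "N + j"] by simp
    also have "\<dots> \<le> r * (r ^ j * u N + d) + d * (1 - r)"
      using Suc r N[of "N + j"] by (intro add_mono mult_left_mono) auto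
    also have "\<dots> = r ^ Suc j * u N + d" by (simp add: algebra_simps)
    finally show ?case .
  qed (use \<open>d > 0\<close> in auto)
  have "(\<lambda>j. r ^ j * u N) \<longlonglongrightarrow> 0 * u N"
    using r by (intro tendsto_intros LIMSEQ_power_zero) auto
  then have "eventually (\<lambda>j. r ^ j * u N < d) sequentially"
    using \<open>d > 0\<close> by (intro order_tendstoD) auto
  then obtain M where M: "\<And>j. j \<ge> M \<Longrightarrow> r ^ j * u N < d" by (auto simp: eventually_sequentially)
  have "norm (u k - 0) < \<epsilon>" if "k \<ge> N + M" for k
  proof -
    have "r ^ (k - N) * u N < d" using that by (intro M) simp
    then show ?thesis using bound[of "k - N"] that u(1)[of k] by (simp add: d_def)
  qed
  then show "\<exists>no. \<forall>k\<ge>no. norm (u k - 0) < \<epsilon>" by blast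
qed

definition stable :: "real^'n^'n \<Rightarrow> bool" where
  "stable A \<longleftrightarrow> mpow A \<longlonglongrightarrow> 0"

lemma stable_transpose: "stable A \<Longrightarrow> stable (transpose A)"
  unfolding stable_def transpose_mpow[symmetric]
  using tendsto_transpose[of "mpow A" 0 sequentially] by (simp add: transpose_def zero_vec_def)

lemma norm_smult: "norm (z *s v) = norm z * norm v" for v :: "complex^'n"
  by (simp add: norm_vec_def norm_mult L2_set_right_distrib)

text \<open>A polynomial annihilating the matrix takes the place of its Jordan form. Of its linear factors
  \<open>T - z\<close>, those with \<open>norm z < 1\<close> make the iteration a contraction up to a vanishing error; for the
  others \<open>z\<close> is not in the spectrum, so \<open>T - z\<close> is invertible and can be cancelled.\<close>

lemma eigen_decay:
  fixes A :: "real^'n^'n"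
  assumes "\<And>z. z \<in> complex_spectrum A \<Longrightarrow> norm z < 1"
  shows "(\<lambda>k. mpow (map_matrix complex_of_real A) k *v x) \<longlonglongrightarrow> 0"
proof -
  define T where "T = map_matrix complex_of_real A"
  obtain p where p: "p \<noteq> 0" "\<And>x. poly_at T p x = 0"
    using annihilating_polynomial unfolding T_def by blast
  have step: "(\<lambda>k. mpow T k *v y) \<longlonglongrightarrow> 0"
    if lim: "(\<lambda>k. mpow T k *v (T *v y - z *s y)) \<longlonglongrightarrow> 0" for z y
  proof -
    have eq: "mpow T k *v (T *v y - z *s y) = T *v (mpow T k *v y) - z *s (mpow T k *v y)" for k
      by (simp add: matrix_vector_mult_diff_distrib matrix_vector_mult_smult matrix_vector_mul_assoc mpow_commute)
    show ?thesis
    proof (cases "norm z < 1")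
      case True
      have "(\<lambda>k. norm (mpow T k *v y)) \<longlonglongrightarrow> 0"
      proof (rule contraction_tendsto_0)
        show "(\<lambda>k. norm (mpow T k *v (T *v y - z *s y))) \<longlonglongrightarrow> 0"
          using lim by (rule tendsto_norm_zero)
        fix k
        have "mpow T (Suc k) *v y = z *s (mpow T k *v y) + mpow T k *v (T *v y - z *s y)"
          by (simp add: eq matrix_vector_mul_assoc)
        then show "norm (mpow T (Suc k) *v y) \<le> norm z * norm (mpow T k *v y) + norm (mpow T k *v (T *v y - z *s y))"
          by (metis norm_smult norm_triangle_ineq)
      qed (use True in auto)
      then show ?thesis by (simp add: tendsto_norm_zero_iff)
    next
      case False
      have "z \<notin> complex_spectrum A" using False assms by blast
      have mat: "(T - mat z) *v w = T *v w - z *s w" for w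
        by (simp add: matrix_vector_mult_diff_rdistrib mat_mult_vec)
      then have "inj ((*v) (T - mat z))"
        using not_in_spectrum[OF \<open>z \<notin> complex_spectrum A\<close>]
        by (intro injI) (metis T_def eq_iff_diff_eq_0 matrix_vector_mult_diff_distrib)
      then obtain L where L: "L ** (T - mat z) = mat 1"
        using matrix_left_invertible_injective by blast
      have "L *v (mpow T k *v (T *v y - z *s y)) = mpow T k *v y" for k
      proof -
        have "L *v (mpow T k *v (T *v y - z *s y)) = L *v ((T - mat z) *v (mpow T k *v y))"
          by (simp only: eq mat)
        also have "\<dots> = mpow T k *v y" by (simp only: matrix_vector_mul_assoc[of L] L matrix_vector_mul_lid)
        finally show ?thesis .
      qed
      moreover have "(\<lambda>k. L *v (mpow T k *v (T *v y - z *s y))) \<longlonglongrightarrow> L *v 0"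
        by (rule bounded_linear.tendsto[OF matrix_vector_mul_bounded_linear lim])
      ultimately show ?thesis by simp
    qed
  qed
  show ?thesis unfolding T_def[symmetric]
    by (rule poly_at_induct[OF p(1) p(2)]) (simp, rule step)
qed

text \<open>The columns of the powers are the orbits of the basis vectors, which decay by
  \<open>eigen_decay\<close>. Conversely, along an eigenvector the powers act as
  \<open>z ^ k\<close>, and these can tend to 0 only if \<open>norm z < 1\<close>.\<close>

theorem spec_radius_less_1_iff: "spec_radius A < 1 \<longleftrightarrow> stable A"
proof
  assume "spec_radius A < 1"
  then have *: "(\<lambda>k. mpow (map_matrix complex_of_real A) k *v x) \<longlonglongrightarrow> 0" for x
    by (intro eigen_decay) (simp add: spec_radius_less_iff)
  have "(\<lambda>k. mpow A k $ i $ j) \<longlonglongrightarrow> 0" for i j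
  proof -
    have "(\<lambda>k. (mpow (map_matrix complex_of_real A) k *v axis j 1) $ i) \<longlonglongrightarrow> 0 $ i"
      using * by (rule tendsto_vec_nth)
    then have "(\<lambda>k. complex_of_real (mpow A k $ i $ j)) \<longlonglongrightarrow> of_real 0"
      by (simp add: matrix_vector_mult_def axis_def mult_delta_right map_matrix_of_real_mpow[symmetric])
    then show ?thesis by (simp only: tendsto_of_real_iff)
  qed
  then show "stable A" unfolding stable_def by (intro vec_tendstoI) simp
next
  assume st: "stable A"
  show "spec_radius A < 1" unfolding spec_radius_less_iff
  proof
    fix z assume "z \<in> complex_spectrum A"
    then obtain v where v: "v \<noteq> 0" "map_matrix complex_of_real A *v v = z *s v"
      by (auto simp: complex_spectrum_def)
    have pow: "mpow (map_matrix complex_of_real A) k *v v = z ^ k *s v" for k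
    proof (induction k)
      case (Suc k)
      then show ?case
        by (simp add: matrix_vector_mul_assoc[symmetric] matrix_vector_mult_smult v mult.commute vector_smult_assoc)
    qed simp
    have "(\<lambda>k. mpow (map_matrix complex_of_real A) k *v v) \<longlonglongrightarrow> 0"
    proof (rule vec_tendstoI)
      fix i
      have "(\<lambda>k. mpow A k $ i $ j) \<longlonglongrightarrow> 0 $ i $ j" for j
        using st unfolding stable_def by (intro tendsto_vec_nth)
      then have "(\<lambda>k. \<Sum>j\<in>UNIV. of_real (mpow A k $ i $ j) * v $ j) \<longlonglongrightarrow> (\<Sum>j\<in>UNIV. of_real 0 * v $ j)"
        by (intro tendsto_intros) simp
      then show "(\<lambda>k. (mpow (map_matrix complex_of_real A) k *v v) $ i) \<longlonglongrightarrow> 0 $ i"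
        by (simp add: matrix_vector_mult_def map_matrix_of_real_mpow[symmetric])
    qed
    then have "(\<lambda>k. norm (z ^ k *s v)) \<longlonglongrightarrow> 0" unfolding pow by (rule tendsto_norm_zero)
    then have "(\<lambda>k. norm z ^ k * norm v / norm v) \<longlonglongrightarrow> 0 / norm v"
      using v(1) by (intro tendsto_intros) (simp_all add: norm_smult norm_power)
    then have "(\<lambda>k. norm z ^ k) \<longlonglongrightarrow> 0" using v(1) by simp
    then have "eventually (\<lambda>k. norm z ^ k < 1) sequentially" by (rule order_tendstoD) simp
    then obtain k where "norm z ^ k < 1" by (auto simp: eventually_sequentially)
    then show "norm z < 1" using one_le_power[of "norm z" k] by linarith
  qed
qed

section \<open>Quadratic forms, semidefinite matrices and traces\<close>

lemma inner_matrix_vector: "x \<bullet> (A *v y) = (transpose A *v x) \<bullet> y" for A :: "real^'m^'n"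
  by (simp add: dot_lmul_matrix)

lemma inner_congruence: "x \<bullet> ((C ** S ** transpose C) *v x) = (transpose C *v x) \<bullet> (S *v (transpose C *v x))"
  for C :: "real^'m^'n"
  by (simp only: matrix_vector_mul_assoc[symmetric] inner_matrix_vector[of x])

lemma matrix_eqI: "(\<And>x. M *v x = N *v x) \<Longrightarrow> M = N" for M N :: "real^'m^'n"
  by (simp add: matrix_eq)

lemma matrix_mult_add_left: "(M + N) ** X = M ** X + N ** X" for X :: "real^'k^'m"
  by (rule bounded_bilinear.add_left[OF bounded_bilinear_matrix_mult])

lemma matrix_mult_diff_left: "(M - N) ** X = M ** X - N ** X" for X :: "real^'k^'m"
  by (rule bounded_bilinear.diff_left[OF bounded_bilinear_matrix_mult])

lemma matrix_mult_diff_right: "X ** (M - N) = X ** M - X ** N" for X :: "real^'k^'m"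
  by (rule bounded_bilinear.diff_right[OF bounded_bilinear_matrix_mult])

lemma transpose_add: "transpose (M + N) = transpose M + transpose N"
  by (simp add: transpose_def vec_eq_iff)

lemma transpose_diff: "transpose (M - N) = transpose M - transpose N"
  by (simp add: transpose_def vec_eq_iff)

lemma pos_def_imp_pos_semidef: "pos_def M \<Longrightarrow> pos_semidef M"
  unfolding pos_def_def pos_semidef_def by (metis inner_zero_left order.refl order.strict_implies_order)

text \<open>The form attains a positive minimum on the compact unit sphere and scales
  quadratically.\<close>

lemma pos_def_lower_bound:
  fixes M :: "real^'n^'n"
  assumes "pos_def M"
  shows "\<exists>c>0. \<forall>x. c * (norm x)\<^sup>2 \<le> x \<bullet> (M *v x)"
proof -
  let ?q = "\<lambda>x. x \<bullet> (M *v x)"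
  have "continuous_on (sphere 0 1) ?q" by (intro continuous_intros linear_continuous_on) auto
  moreover have "sphere (0 :: real^'n) 1 \<noteq> {}" by simp
  ultimately obtain u where u: "u \<in> sphere 0 1" "\<And>x. x \<in> sphere 0 1 \<Longrightarrow> ?q u \<le> ?q x"
    using continuous_attains_inf[OF compact_sphere, of "0 :: real^'n" 1 ?q] by blast
  have "u \<noteq> 0" using u(1) by auto
  then have "?q u > 0" using assms unfolding pos_def_def by blast
  moreover have "?q u * (norm x)\<^sup>2 \<le> ?q x" for x
  proof (cases "x = 0")
    case False
    have "?q u \<le> ?q (x /\<^sub>R norm x)" using False by (intro u(2)) simp
    also have "\<dots> = ?q x / (norm x)\<^sup>2"
      by (simp add: matrix_vector_mult_scaleR power2_eq_square divide_inverse)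
    finally show ?thesis using False by (simp add: field_simps)
  qed simp
  ultimately show ?thesis by blast
qed

lemma quadratic_form_upper_bound: "\<exists>c>0. \<forall>x. x \<bullet> (M *v x) \<le> c * (norm x)\<^sup>2" for M :: "real^'n^'n"
proof -
  obtain c where c: "c > 0" "\<And>x. norm (M *v x) \<le> norm x * c"
    using bounded_linear.pos_bounded[OF matrix_vector_mul_bounded_linear[of M]] by blast
  have "x \<bullet> (M *v x) \<le> c * (norm x)\<^sup>2" for x
  proof -
    have "x \<bullet> (M *v x) \<le> norm x * norm (M *v x)" by (rule norm_cauchy_schwarz)
    also have "\<dots> \<le> norm x * (norm x * c)" by (intro mult_left_mono c) simp
    finally show ?thesis by (simp add: power2_eq_square ac_simps)
  qed
  with c(1) show ?thesis by blast
qed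

lemma pos_def_surj:
  assumes "pos_def M" shows "surj ((*v) M)"
proof -
  have "inj ((*v) M)"
  proof (rule injI)
    fix x y assume "M *v x = M *v y"
    then have "(x - y) \<bullet> (M *v (x - y)) = 0" by (simp add: matrix_vector_mult_diff_distrib)
    then show "x = y" using assms unfolding pos_def_def by (metis eq_iff_diff_eq_0 less_irrefl)
  qed
  then show ?thesis by (simp add: linear_injective_imp_surjective)
qed

lemma pos_semidef_cauchy_schwarz:
  assumes "pos_semidef M"
  shows "(x \<bullet> (M *v y))\<^sup>2 \<le> (x \<bullet> (M *v x)) * (y \<bullet> (M *v y))"
proof -
  define a b d where abd: "a = x \<bullet> (M *v x)" "b = x \<bullet> (M *v y)" "d = y \<bullet> (M *v y)"
  have sym: "y \<bullet> (M *v x) = b"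
    using assms by (metis abd(2) inner_commute inner_matrix_vector pos_semidef_def)
  have nonneg: "0 \<le> z \<bullet> (M *v z)" for z using assms by (simp add: pos_semidef_def)
  have q: "0 \<le> a + 2 * t * b + t\<^sup>2 * d" for t
    using nonneg[of "x + t *\<^sub>R y"] sym
    by (simp add: matrix_vector_right_distrib matrix_vector_mult_scaleR inner_add_left inner_add_right
        abd power2_eq_square algebra_simps)
  have "d \<ge> 0" unfolding abd by (rule nonneg)
  show ?thesis
  proof (cases "d = 0")
    case True
    have "b = 0"
    proof (rule ccontr)
      assume "b \<noteq> 0"
      \<comment> \<open>For \<open>d = 0\<close> the quadratic in \<open>t\<close> is affine, and
        this \<open>t\<close> gives it the value -1.\<close>
      then show False using q[of "- (a + 1) / (2 * b)"] True by (simp add: field_simps)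
    qed
    then show ?thesis using True by (simp add: abd)
  next
    case False
    then have "d > 0" using \<open>d \<ge> 0\<close> by simp
    have "0 \<le> a - b\<^sup>2 / d"
      \<comment> \<open>This \<open>t\<close> minimizes the quadratic.\<close>
      using q[of "- b / d"] False by (simp add: power2_eq_square field_simps)
    then show ?thesis using \<open>d > 0\<close> unfolding abd[symmetric] by (simp add: field_simps)
  qed
qed

text \<open>Symmetric Gaussian elimination: subtracting \<open>u u\<^sup>T / c\<close>, with \<open>u\<close> the pivot column and
  \<open>c\<close> the pivot, clears one row. A zero pivot has \<open>u = 0\<close> by Cauchy-Schwarz, so \<open>x / 0 = 0\<close>
  makes the same formula correct.\<close>

lemma pos_semidef_sum_squares_supported:
  fixes M :: "real^'n^'n"
  assumes "finite I" "pos_semidef M" "\<And>i j. i \<notin> I \<Longrightarrow> M $ i $ j = 0"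
  shows "\<exists>v. \<forall>x. M *v x = (\<Sum>i\<in>I. (v i \<bullet> x) *\<^sub>R v i)"
  using assms
proof (induction I arbitrary: M rule: finite_induct)
  case empty
  then have "M = 0" by (simp add: vec_eq_iff)
  then show ?case by simp
next
  case (insert k I)
  let ?e = "axis k 1 :: real^'n"
  define u where "u = M *v ?e"
  define c where "c = M $ k $ k"
  have sym: "transpose M = M" using insert.prems by (simp add: pos_semidef_def)
  then have msym: "M $ i $ j = M $ j $ i" for i j by (metis transpose_def vec_lambda_beta)
  have ui: "u $ i = M $ i $ k" for i by (simp add: u_def matrix_vector_mult_basis column_def)
  have eM: "?e \<bullet> (M *v x) = u \<bullet> x" for x by (simp add: inner_matrix_vector[of ?e] sym u_def)
  have cq: "?e \<bullet> (M *v ?e) = c" by (simp add: u_def[symmetric] inner_axis' ui c_def)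
  have "c \<ge> 0" using insert.prems(1) unfolding cq[symmetric] pos_semidef_def by blast
  have cs: "(u \<bullet> x)\<^sup>2 \<le> c * (x \<bullet> (M *v x))" for x
    using pos_semidef_cauchy_schwarz[OF insert.prems(1), of ?e x] unfolding cq unfolding eM .
  have u0: "u = 0" if "c = 0" using cs[of u] that by simp
  define M' where "M' = (\<chi> i j. M $ i $ j - u $ i * u $ j / c)"
  have M': "M' *v x = M *v x - ((u \<bullet> x) / c) *\<^sub>R u" for x
    by (simp add: M'_def vec_eq_iff matrix_vector_mult_def inner_vec_def sum_subtractf
        sum_distrib_left sum_divide_distrib algebra_simps)
  have "pos_semidef M'"
    unfolding pos_semidef_def
  proof (intro conjI allI)
    show "transpose M' = M'" by (simp add: M'_def transpose_def vec_eq_iff msym mult.commute)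
    fix x
    show "0 \<le> x \<bullet> (M' *v x)"
      using cs[of x] \<open>c \<ge> 0\<close> insert.prems(1) u0
      by (cases "c = 0") (auto simp: M' inner_diff_right inner_commute power2_eq_square field_simps pos_semidef_def)
  qed
  moreover have "M' $ i $ j = 0" if "i \<notin> I" for i j
  proof (cases "i = k")
    case True
    have "u $ k = c" by (simp add: ui c_def)
    then show ?thesis using True u0 ui[of j] msym[of k j] by (cases "c = 0") (auto simp: M'_def)
  next
    case False
    then show ?thesis using that insert.prems(2)[of i] by (simp add: M'_def ui)
  qed
  ultimately obtain v where v: "\<And>x. M' *v x = (\<Sum>i\<in>I. (v i \<bullet> x) *\<^sub>R v i)"
    using insert.IH by blast
  define v' where "v' = v(k := (1 / sqrt c) *\<^sub>R u)"
  have "M *v x = (\<Sum>i\<in>insert k I. (v' i \<bullet> x) *\<^sub>R v' i)" for x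
  proof -
    have "(\<Sum>i\<in>insert k I. (v' i \<bullet> x) *\<^sub>R v' i) = (v' k \<bullet> x) *\<^sub>R v' k + M' *v x"
      using insert.hyps by (simp add: v v'_def) (rule sum.cong, auto)
    also have "(v' k \<bullet> x) *\<^sub>R v' k = ((u \<bullet> x) / c) *\<^sub>R u"
      using \<open>c \<ge> 0\<close> by (simp add: v'_def)
    finally show ?thesis by (simp add: M')
  qed
  then show ?case by blast
qed

text \<open>Writing \<open>S\<close> as a sum of \<open>v v^T\<close> turns a trace against
  \<open>S\<close> into a sum of quadratic forms, so traces are compared by comparing forms
  pointwise. The first property is kept because the span of the \<open>v i\<close> matters
  later.\<close>

lemma pos_semidef_trace:
  fixes S :: "real^'n^'n"
  assumes "pos_semidef S"
  obtains v :: "'n \<Rightarrow> real^'n"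
  where "\<And>x. S *v x = (\<Sum>i\<in>UNIV. (v i \<bullet> x) *\<^sub>R v i)"
    and "\<And>X. trace (X ** S) = (\<Sum>i\<in>UNIV. v i \<bullet> (X *v v i))"
proof -
  obtain v where v: "\<And>x. S *v x = (\<Sum>i\<in>(UNIV::'n set). (v i \<bullet> x) *\<^sub>R v i)"
    using pos_semidef_sum_squares_supported[OF finite assms] by auto
  have S: "S $ a $ b = (\<Sum>i\<in>UNIV. v i $ a * v i $ b)" for a b
  proof -
    have "S $ a $ b = (S *v axis b 1) $ a" by (simp add: matrix_vector_mult_basis column_def)
    then show ?thesis by (simp add: v sum_component inner_axis mult.commute)
  qed
  have "trace (X ** S) = (\<Sum>i\<in>UNIV. v i \<bullet> (X *v v i))" for X
  proof -
    have "trace (X ** S) = (\<Sum>a\<in>UNIV. \<Sum>b\<in>UNIV. \<Sum>i\<in>UNIV. v i $ a * (X $ a $ b * v i $ b))"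
      by (simp add: trace_def matrix_matrix_mult_def S sum_distrib_left ac_simps)
    also have "\<dots> = (\<Sum>a\<in>UNIV. \<Sum>i\<in>UNIV. \<Sum>b\<in>UNIV. v i $ a * (X $ a $ b * v i $ b))"
      by (subst (2) sum.swap) (rule refl)
    also have "\<dots> = (\<Sum>i\<in>UNIV. \<Sum>a\<in>UNIV. \<Sum>b\<in>UNIV. v i $ a * (X $ a $ b * v i $ b))"
      by (rule sum.swap)
    finally show ?thesis by (simp add: inner_vec_def matrix_vector_mult_def sum_distrib_left)
  qed
  with v show thesis by (rule that)
qed

lemma trace_mono:
  assumes "pos_semidef S" "\<And>x. x \<bullet> (X *v x) \<le> x \<bullet> (Y *v x)"
  shows "trace (X ** S) \<le> trace (Y ** S)"
  by (rule pos_semidef_trace[OF assms(1)]) (simp add: sum_mono assms(2))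

lemma trace_nonneg:
  assumes "pos_semidef S" "\<And>x. 0 \<le> x \<bullet> (X *v x)"
  shows "0 \<le> trace (X ** S)"
  by (rule pos_semidef_trace[OF assms(1)]) (simp add: sum_nonneg assms(2))

lemma scaleR_mult_matrix: "(c *\<^sub>R X) ** Y = c *\<^sub>R (X ** Y)" for X :: "real^'m^'n"
  by (simp add: vec_eq_iff matrix_matrix_mult_def sum_distrib_left mult.assoc)

lemma trace_scaleR: "trace (c *\<^sub>R X) = c * trace X" for X :: "real^'n^'n"
  by (simp add: trace_def sum_distrib_left)

lemma trace_lower_bound:
  assumes "pos_semidef S" "\<And>x. c * (norm x)\<^sup>2 \<le> x \<bullet> (X *v x)"
  shows "c * trace S \<le> trace (X ** S)"
proof -
  have "x \<bullet> ((c *\<^sub>R mat 1) *v x) \<le> x \<bullet> (X *v x)" for x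
    using assms(2)[of x] by (simp add: scaleR_matrix_vector_assoc[symmetric] power2_norm_eq_inner)
  from trace_mono[OF assms(1) this] show ?thesis by (simp add: scaleR_mult_matrix trace_scaleR)
qed

text \<open>Cauchy-Schwarz on basis vectors bounds every entry by diagonal ones, hence by the trace;
  the factor counts the entries.\<close>

lemma pos_semidef_norm_le_trace:
  fixes S :: "real^'n^'n"
  assumes "pos_semidef S"
  shows "norm S \<le> real (CARD('n)) ^ 2 * trace S"
proof -
  have ent: "axis i 1 \<bullet> (S *v axis j 1) = S $ i $ j" for i j
    by (simp add: matrix_vector_mult_basis inner_axis' column_def)
  have diag: "0 \<le> S $ i $ i" for i
    using assms ent[of i i] unfolding pos_semidef_def by metis
  have "S $ i $ i \<le> trace S" for i
    unfolding trace_def by (rule member_le_sum) (auto simp: diag)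
  then have "\<bar>S $ i $ j\<bar> \<le> trace S" for i j
  proof -
    have "(S $ i $ j)\<^sup>2 \<le> S $ i $ i * S $ j $ j"
      using pos_semidef_cauchy_schwarz[OF assms, of "axis i 1" "axis j 1"] by (simp only: ent)
    also have "\<dots> \<le> trace S * trace S"
      using \<open>\<And>i. S $ i $ i \<le> trace S\<close> diag by (intro mult_mono) (auto intro: order_trans)
    finally have "\<bar>S $ i $ j\<bar>\<^sup>2 \<le> (trace S)\<^sup>2" by (simp add: power2_eq_square)
    moreover have "0 \<le> trace S" using diag by (simp add: trace_def sum_nonneg)
    ultimately show ?thesis by (rule power2_le_imp_le)
  qed
  note ab = this
  have "norm S \<le> (\<Sum>i\<in>UNIV. norm (S $ i))" by (simp add: norm_vec_def L2_set_le_sum)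
  also have "\<dots> \<le> (\<Sum>i\<in>(UNIV::'n set). \<Sum>j\<in>(UNIV::'n set). trace S)"
    by (intro sum_mono order_trans[OF norm_le_l1_cart]) (use ab in auto)
  also have "\<dots> = real (CARD('n)) ^ 2 * trace S" by (simp add: power2_eq_square)
  finally show ?thesis .
qed

lemma trace_gram: "trace (transpose K ** K) = (norm K)\<^sup>2" for K :: "real^'m^'n"
proof -
  have "trace (transpose K ** K) = (\<Sum>j\<in>UNIV. \<Sum>i\<in>UNIV. K $ i $ j * K $ i $ j)"
    by (simp add: trace_def transpose_def matrix_matrix_mult_def)
  also have "\<dots> = (\<Sum>i\<in>UNIV. \<Sum>j\<in>UNIV. K $ i $ j * K $ i $ j)" by (rule sum.swap)
  finally show ?thesis by (simp add: power2_norm_eq_inner inner_vec_def)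
qed

section \<open>Lyapunov equations\<close>

lemma lyapunov_iterate:
  fixes C S :: "real^'n^'n"
  assumes "S = C ** S ** transpose C"
  shows "S = mpow C k ** S ** transpose (mpow C k)"
proof (induction k)
  case (Suc k)
  have "mpow C (Suc k) ** S ** transpose (mpow C (Suc k)) = C ** (mpow C k ** S ** transpose (mpow C k)) ** transpose C"
    by (simp add: matrix_transpose_mul matrix_mul_assoc)
  then show ?case using Suc assms by simp
qed simp

lemma stable_congruence_tendsto:
  assumes "stable C"
  shows "(\<lambda>k. mpow C k ** S ** transpose (mpow C k)) \<longlonglongrightarrow> 0"
proof -
  have "(\<lambda>k. mpow C k ** S ** transpose (mpow C k)) \<longlonglongrightarrow> 0 ** S ** transpose 0"
    using assms unfolding stable_def by (intro tendsto_intros)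
  then show ?thesis by (simp add: matrix_matrix_mult_def zero_vec_def)
qed

text \<open>No series is summed: the map taking \<open>S\<close> to
  \<open>S - C ** S ** transpose C\<close> is linear on a finite-dimensional space, and injective
  because an element of its kernel equals all its decaying iterates.\<close>

lemma lyapunov_ex1:
  fixes C W :: "real^'n^'n"
  assumes "stable C"
  shows "\<exists>!S. S = C ** S ** transpose C + W"
proof -
  let ?F = "\<lambda>S. S - C ** S ** transpose C"
  have lin: "linear ?F"
  proof (rule linearI)
    fix c and X Y :: "real^'n^'n"
    show "?F (X + Y) = ?F X + ?F Y" by (simp add: matrix_add_ldistrib matrix_mult_add_left)
    show "?F (c *\<^sub>R X) = c *\<^sub>R ?F X"
      by (simp add: scaleR_mult_matrix bounded_bilinear.scaleR_right[OF bounded_bilinear_matrix_mult] scaleR_diff_right)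
  qed
  have "X = 0" if "?F X = 0" for X
  proof -
    have "X = C ** X ** transpose C" using that by simp
    then have "X = mpow C k ** X ** transpose (mpow C k)" for k by (rule lyapunov_iterate)
    then have "(\<lambda>k. X) \<longlonglongrightarrow> 0" using stable_congruence_tendsto[OF assms, of X] by simp
    then show ?thesis by (simp add: LIMSEQ_const_iff)
  qed
  then have inj: "inj ?F" using lin by (simp add: linear_injective_0)
  obtain S where S: "?F S = W" using surjD[OF linear_injective_imp_surjective[OF lin inj], of W] by auto
  show ?thesis
  proof (rule ex1I)
    show "S = C ** S ** transpose C + W" using S by (simp add: algebra_simps)
    fix S' assume "S' = C ** S' ** transpose C + W"
    then have "?F S' = ?F S" unfolding S diff_eq_eq add.commute[of W] .
    then show "S' = S" by (rule injD[OF inj])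
  qed
qed

lemma lyapunov_symmetric:
  assumes "stable C" "S = C ** S ** transpose C + W" "transpose W = W"
  shows "transpose S = S"
proof -
  have "transpose S = transpose (C ** S ** transpose C + W)" using assms(2) by simp
  then have "transpose S = C ** transpose S ** transpose C + W"
    by (simp add: transpose_add matrix_transpose_mul assms(3) matrix_mul_assoc)
  then show ?thesis using lyapunov_ex1[OF assms(1)] assms(2) by blast
qed

text \<open>Unrolling the equation only drops nonnegative terms, so the form of \<open>S\<close>
  dominates iterates that tend to 0 and is nonnegative. One more unrolling then leaves the form of
  \<open>W\<close> as a lower bound.\<close>

lemma lyapunov_ge:
  assumes "stable C" "S = C ** S ** transpose C + W" "\<And>x. 0 \<le> x \<bullet> (W *v x)"
  shows "x \<bullet> (W *v x) \<le> x \<bullet> (S *v x)"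
proof -
  have step: "x \<bullet> (S *v x) = (transpose C *v x) \<bullet> (S *v (transpose C *v x)) + x \<bullet> (W *v x)" for x
    by (subst assms(2)) (simp only: matrix_vector_mult_add_rdistrib inner_add_right inner_congruence)
  have iter: "x \<bullet> ((mpow C k ** S ** transpose (mpow C k)) *v x) \<le> x \<bullet> (S *v x)" for x k
  proof (induction k arbitrary: x)
    case (Suc k)
    have "transpose (mpow C (Suc k)) *v x = transpose (mpow C k) *v (transpose C *v x)"
      by (simp only: mpow.simps matrix_transpose_mul matrix_vector_mul_assoc)
    then show ?case
      using Suc[of "transpose C *v x"] step[of x] assms(3)[of x] unfolding inner_congruence by simp
  qed simp
  have nonneg: "0 \<le> x \<bullet> (S *v x)" for x
  proof (rule LIMSEQ_le_const2)
    show "(\<lambda>k. x \<bullet> ((mpow C k ** S ** transpose (mpow C k)) *v x)) \<longlonglongrightarrow> 0"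
      using tendsto_inner[OF tendsto_const tendsto_matrix_vector_mult[OF stable_congruence_tendsto[OF assms(1), of S] tendsto_const], of x x]
      by simp
  qed (use iter in auto)
  show ?thesis using step[of x] nonneg[of "transpose C *v x"] by linarith
qed

lemma lyapunov_pos_def:
  assumes "stable C" "S = C ** S ** transpose C + W" "pos_def W"
  shows "pos_def S"
  using lyapunov_symmetric[OF assms(1,2)] lyapunov_ge[OF assms(1,2)] assms(3)
    pos_def_imp_pos_semidef[OF assms(3)]
  unfolding pos_def_def pos_semidef_def by (meson less_le_trans)

text \<open>The form \<open>x \<bullet> S x\<close> is a Lyapunov function of the transposed system, decreasing by a factor
  \<open>1 - w / m\<close> in each step.\<close>

lemma lyapunov_stable:
  assumes eq: "S = C ** S ** transpose C + W"
    and s: "s > 0" "\<And>x. s * (norm x)\<^sup>2 \<le> x \<bullet> (S *v x)"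
    and w: "w > 0" "\<And>x. w * (norm x)\<^sup>2 \<le> x \<bullet> (W *v x)"
  shows "stable C"
proof -
  obtain m where m: "m > 0" "\<And>x. x \<bullet> (S *v x) \<le> m * (norm x)\<^sup>2"
    using quadratic_form_upper_bound by blast
  \<comment> \<open>The maximum makes \<open>r\<close> nonnegative without comparing
    \<open>w\<close> and \<open>m\<close>.\<close>
  define r where "r = max 0 (1 - w / m)"
  have r: "0 \<le> r" "r < 1" using m w by (auto simp: r_def)
  have q0: "0 \<le> x \<bullet> (S *v x)" for x using s by (meson less_imp_le mult_nonneg_nonneg order_trans zero_le_power2)
  have step: "(transpose C *v x) \<bullet> (S *v (transpose C *v x)) \<le> r * (x \<bullet> (S *v x))" for x
  proof -
    have "x \<bullet> (S *v x) = (transpose C *v x) \<bullet> (S *v (transpose C *v x)) + x \<bullet> (W *v x)"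
      by (subst eq) (simp only: matrix_vector_mult_add_rdistrib inner_add_right inner_congruence)
    moreover have "w / m * (x \<bullet> (S *v x)) \<le> w * (norm x)\<^sup>2"
      using m(2)[of x] m(1) w(1) by (simp add: field_simps)
    ultimately have "(transpose C *v x) \<bullet> (S *v (transpose C *v x)) \<le> (1 - w / m) * (x \<bullet> (S *v x))"
      using w(2)[of x] by (simp add: algebra_simps)
    also have "\<dots> \<le> r * (x \<bullet> (S *v x))" by (intro mult_right_mono q0) (simp add: r_def)
    finally show ?thesis .
  qed
  have decay: "(mpow (transpose C) k *v x) \<bullet> (S *v (mpow (transpose C) k *v x)) \<le> r ^ k * (x \<bullet> (S *v x))" for k x
  proof (induction k)
    case (Suc k)
    have "(mpow (transpose C) (Suc k) *v x) \<bullet> (S *v (mpow (transpose C) (Suc k) *v x))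
        \<le> r * ((mpow (transpose C) k *v x) \<bullet> (S *v (mpow (transpose C) k *v x)))"
      using step[of "mpow (transpose C) k *v x"] by (simp only: mpow.simps matrix_vector_mul_assoc)
    also have "\<dots> \<le> r * (r ^ k * (x \<bullet> (S *v x)))" using Suc r(1) by (rule mult_left_mono)
    finally show ?case by (simp add: mult.assoc)
  qed simp
  have "stable (transpose C)" unfolding stable_def
  proof (rule matrix_tendsto_0I)
    fix x
    have "(\<lambda>k. (norm (mpow (transpose C) k *v x))\<^sup>2) \<longlonglongrightarrow> 0"
    proof (rule tendsto_sandwich[OF _ _ tendsto_const])
      show "\<forall>\<^sub>F k in sequentially. (norm (mpow (transpose C) k *v x))\<^sup>2 \<le> r ^ k * (x \<bullet> (S *v x)) / s"
        using s decay[of _ x] order_trans by (intro always_eventually) (fastforce simp: field_simps)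
      have "(\<lambda>k. r ^ k * (x \<bullet> (S *v x)) / s) \<longlonglongrightarrow> 0 * (x \<bullet> (S *v x)) / s"
        using r s(1) by (intro tendsto_intros LIMSEQ_power_zero) auto
      then show "(\<lambda>k. r ^ k * (x \<bullet> (S *v x)) / s) \<longlonglongrightarrow> 0" by simp
    qed simp
    then have "(\<lambda>k. norm (mpow (transpose C) k *v x)) \<longlonglongrightarrow> 0"
      using tendsto_real_sqrt by fastforce
    then show "(\<lambda>k. mpow (transpose C) k *v x) \<longlonglongrightarrow> 0" by (simp add: tendsto_norm_zero_iff)
  qed
  then have "stable (transpose (transpose C))" by (rule stable_transpose)
  then show ?thesis by simp
qed

lemma eventually_pos_def_bound:
  fixes M :: "'a \<Rightarrow> real^'n^'n"
  assumes "(M \<longlongrightarrow> W) F" "pos_def W"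
  shows "\<exists>c>0. \<forall>\<^sub>F t in F. \<forall>x. c * (norm x)\<^sup>2 \<le> x \<bullet> (M t *v x)"
proof -
  obtain w where w: "w > 0" "\<And>x. w * (norm x)\<^sup>2 \<le> x \<bullet> (W *v x)"
    using pos_def_lower_bound[OF assms(2)] by blast
  obtain k where k: "k > 0" "\<And>(X :: real^'n^'n) x. norm (X *v x) \<le> norm X * norm x * k"
    using bounded_bilinear.pos_bounded[OF bounded_bilinear_matrix_vector_mult] by blast
  \<comment> \<open>With \<open>k\<close> the constant of the matrix-vector product, this closeness
    costs at most half of the lower bound \<open>w\<close>, uniformly in \<open>x\<close>.\<close>
  have "\<forall>\<^sub>F t in F. dist (M t) W < w / (2 * k)"
    using assms(1) w(1) k(1) by (intro tendstoD) auto
  then have "\<forall>\<^sub>F t in F. \<forall>x. (w / 2) * (norm x)\<^sup>2 \<le> x \<bullet> (M t *v x)"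
  proof (rule eventually_mono, intro allI)
    fix t and x :: "real^'n" assume t: "dist (M t) W < w / (2 * k)"
    have "- (x \<bullet> ((M t - W) *v x)) \<le> norm x * norm ((M t - W) *v x)"
      using norm_cauchy_schwarz[of "- x"] by simp
    also have "\<dots> \<le> norm x * (norm (M t - W) * norm x * k)" by (intro mult_left_mono k) simp
    also have "\<dots> = (norm (M t - W) * k) * (norm x)\<^sup>2" by (simp add: power2_eq_square)
    also have "\<dots> \<le> (w / 2) * (norm x)\<^sup>2"
      using t k(1) by (intro mult_right_mono) (auto simp: dist_norm field_simps)
    finally show "(w / 2) * (norm x)\<^sup>2 \<le> x \<bullet> (M t *v x)"
      using w(2)[of x] by (simp add: matrix_vector_mult_diff_rdistrib inner_diff_right)
  qed
  then show ?thesis using w(1) by (intro exI[of _ "w / 2"]) auto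
qed

section \<open>The LQR cost\<close>

locale lqr =
  fixes A W :: "real^'n^'n" and B :: "real^'m^'n" and R :: "real^'m^'m"
  assumes W: "pos_def W" and R: "pos_def R"
begin

definition gains :: "(real^'n^'m) set" where
  "gains = {K. stable (A + B ** K)}"

definition Sig :: "real^'n^'m \<Rightarrow> real^'n^'n" where
  "Sig K = (THE S. S = (A + B ** K) ** S ** transpose (A + B ** K) + W)"

definition cost :: "real^'n^'n \<Rightarrow> real^'n^'m \<Rightarrow> real" where
  "cost M K = trace ((M + transpose K ** R ** K) ** Sig K)"

lemma Sig_eqI:
  assumes "K \<in> gains" "S = (A + B ** K) ** S ** transpose (A + B ** K) + W"
  shows "Sig K = S"
  unfolding Sig_def
  by (rule the1_equality[OF lyapunov_ex1]) (use assms gains_def in auto)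

lemma Sig_eq:
  assumes "K \<in> gains"
  shows "Sig K = (A + B ** K) ** Sig K ** transpose (A + B ** K) + W"
  unfolding Sig_def by (rule theI'[OF lyapunov_ex1]) (use assms gains_def in auto)

lemma Sig_pos_def: "K \<in> gains \<Longrightarrow> pos_def (Sig K)"
  using lyapunov_pos_def[OF _ Sig_eq W] by (simp add: gains_def)

lemma Sig_pos_semidef: "K \<in> gains \<Longrightarrow> pos_semidef (Sig K)"
  using Sig_pos_def pos_def_imp_pos_semidef by blast

lemma Sig_ge_W: "K \<in> gains \<Longrightarrow> x \<bullet> (W *v x) \<le> x \<bullet> (Sig K *v x)"
  using lyapunov_ge[OF _ Sig_eq] pos_def_imp_pos_semidef[OF W] by (simp add: gains_def pos_semidef_def)

lemma symR: "x \<bullet> (R *v y) = y \<bullet> (R *v x)"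
  using R by (metis inner_commute inner_matrix_vector pos_def_def)

section \<open>Value matrices and the expansion of the cost around a gain\<close>

definition value_matrix :: "real^'n^'n \<Rightarrow> real^'n^'m \<Rightarrow> real^'n^'n \<Rightarrow> bool" where
  "value_matrix M K X \<longleftrightarrow>
     X = transpose (A + B ** K) ** X ** (A + B ** K) + (M + transpose K ** R ** K)"

text \<open>For the value matrix \<open>X\<close> of \<open>K\<close> and a symmetric weight, the
  gradient of the cost is \<open>2 * cost_gradient K X ** Sig K\<close>. The invertible factor
  \<open>Sig K\<close> does not affect where it vanishes.\<close>

definition cost_gradient :: "real^'n^'m \<Rightarrow> real^'n^'n \<Rightarrow> real^'n^'m" where
  "cost_gradient K X = R ** K + transpose B ** X ** (A + B ** K)"

lemma value_matrix_exists:
  assumes "K \<in> gains"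
  shows "\<exists>X. value_matrix M K X"
proof -
  have "stable (transpose (A + B ** K))" using assms by (simp add: gains_def stable_transpose)
  from ex1_implies_ex[OF lyapunov_ex1[OF this]] show ?thesis by (simp add: value_matrix_def)
qed

lemma weight_symmetric:
  assumes "transpose M = M"
  shows "transpose (M + transpose K ** R ** K) = M + transpose K ** R ** K"
  using assms R by (simp add: transpose_add matrix_transpose_mul pos_def_def matrix_mul_assoc)

lemma value_matrix_symmetric:
  assumes "K \<in> gains" "value_matrix M K X" "transpose M = M"
  shows "transpose X = X"
proof (rule lyapunov_symmetric)
  show "stable (transpose (A + B ** K))" using assms by (simp add: gains_def stable_transpose)
  show "X = transpose (A + B ** K) ** X ** transpose (transpose (A + B ** K)) + (M + transpose K ** R ** K)"
    using assms(2) by (simp add: value_matrix_def)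
qed (rule weight_symmetric[OF assms(3)])

lemma weight_form: "x \<bullet> ((M + transpose K ** R ** K) *v x) = x \<bullet> (M *v x) + (K *v x) \<bullet> (R *v (K *v x))"
proof -
  have "x \<bullet> ((transpose K ** R ** K) *v x) = (K *v x) \<bullet> (R *v (K *v x))"
    using inner_congruence[of x "transpose K" R] by simp
  then show ?thesis by (simp only: matrix_vector_mult_add_rdistrib inner_add_right)
qed

text \<open>Multiply the covariance equation of \<open>K'\<close> by an arbitrary \<open>X\<close>
  and use that the trace is cyclic. The freedom in \<open>X\<close> is the point: inserting the
  value matrix of another gain compares the two costs.\<close>

lemma cost_trace_identity:
  assumes K': "K' \<in> gains"
  shows "cost M K' = trace (X ** W) +
    trace ((transpose (A + B ** K') ** X ** (A + B ** K') + (M + transpose K' ** R ** K') - X) ** Sig K')"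
proof -
  let ?E = "A + B ** K'" and ?S = "Sig K'"
  have "trace (X ** ?S) = trace (X ** (?E ** ?S ** transpose ?E)) + trace (X ** W)"
    by (subst Sig_eq[OF K']) (simp only: matrix_add_ldistrib trace_add)
  also have "trace (X ** (?E ** ?S ** transpose ?E)) = trace ((X ** ?E ** ?S) ** transpose ?E)"
    by (simp only: matrix_mul_assoc)
  also have "\<dots> = trace (transpose ?E ** X ** ?E ** ?S)"
    by (subst trace_mul_sym) (simp only: matrix_mul_assoc)
  finally show ?thesis
    by (simp add: cost_def matrix_mult_add_left trace_add trace_sub
        matrix_mult_diff_left)
qed

text \<open>Completion of the square (the performance difference identity): the expansion of the cost
  around \<open>K\<close> is quadratic in the perturbation \<open>D\<close>, apart from the covariance at \<open>K + D\<close>.\<close>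

lemma cost_expansion:
  assumes K: "K \<in> gains" and KD: "K + D \<in> gains"
    and X: "value_matrix M K X" and M: "transpose M = M"
  obtains v :: "'n \<Rightarrow> real^'n"
  where "\<And>x. Sig (K + D) *v x = (\<Sum>i\<in>UNIV. (v i \<bullet> x) *\<^sub>R v i)"
    and "cost M (K + D) = trace (X ** W) +
      (\<Sum>i\<in>UNIV. 2 * ((D *v v i) \<bullet> (cost_gradient K X *v v i)) +
        ((D *v v i) \<bullet> (R *v (D *v v i)) + (B *v (D *v v i)) \<bullet> (X *v (B *v (D *v v i)))))"
proof -
  obtain v :: "'n \<Rightarrow> real^'n" where v: "\<And>x. Sig (K + D) *v x = (\<Sum>i\<in>UNIV. (v i \<bullet> x) *\<^sub>R v i)"
    "\<And>X. trace (X ** Sig (K + D)) = (\<Sum>i\<in>UNIV. v i \<bullet> (X *v v i))"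
    by (rule pos_semidef_trace[OF Sig_pos_semidef[OF KD]]) (rule that)
  have symX: "x \<bullet> (X *v y) = y \<bullet> (X *v x)" for x y
    using value_matrix_symmetric[OF K X M] by (metis inner_commute inner_matrix_vector)
  have "x \<bullet> ((transpose (A + B ** (K + D)) ** X ** (A + B ** (K + D)) +
        (M + transpose (K + D) ** R ** (K + D)) - X) *v x)
      = 2 * ((D *v x) \<bullet> (cost_gradient K X *v x)) +
        ((D *v x) \<bullet> (R *v (D *v x)) + (B *v (D *v x)) \<bullet> (X *v (B *v (D *v x))))" for x
  proof -
    define a b d k where "a = (A + B ** K) *v x" "b = B *v (D *v x)" "d = D *v x" "k = K *v x"
    note defs = this
    have ab: "(A + B ** (K + D)) *v x = a + b"
      by (simp add: defs matrix_add_ldistrib matrix_vector_mult_add_rdistrib matrix_vector_mul_assoc add.assoc)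
    have kd: "(K + D) *v x = k + d" by (simp add: defs matrix_vector_mult_add_rdistrib)
    have "x \<bullet> (X *v x) = x \<bullet> ((transpose (A + B ** K) ** X ** (A + B ** K)) *v x)
        + x \<bullet> ((M + transpose K ** R ** K) *v x)"
      using X unfolding value_matrix_def
      by (metis inner_add_right matrix_vector_mult_add_rdistrib)
    also have "x \<bullet> ((transpose (A + B ** K) ** X ** (A + B ** K)) *v x) = a \<bullet> (X *v a)"
      using inner_congruence[of x "transpose (A + B ** K)" X] by (simp only: transpose_transpose defs)
    finally have XX: "x \<bullet> (X *v x) = a \<bullet> (X *v a) + (x \<bullet> (M *v x) + k \<bullet> (R *v k))"
      by (simp only: weight_form defs)
    have EE: "x \<bullet> ((transpose (A + B ** (K + D)) ** X ** (A + B ** (K + D))) *v x) = (a + b) \<bullet> (X *v (a + b))"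
      using inner_congruence[of x "transpose (A + B ** (K + D))" X] by (simp only: transpose_transpose ab)
    have MM: "x \<bullet> ((M + transpose (K + D) ** R ** (K + D)) *v x) = x \<bullet> (M *v x) + (k + d) \<bullet> (R *v (k + d))"
      by (simp only: weight_form kd)
    have "d \<bullet> ((transpose B ** X ** (A + B ** K)) *v x) = b \<bullet> (X *v a)"
      by (simp only: matrix_vector_mul_assoc[symmetric] inner_matrix_vector[of "D *v x" "transpose B"] transpose_transpose defs)
    moreover have "(R ** K) *v x = R *v k" by (simp add: defs matrix_vector_mul_assoc)
    ultimately have GG: "d \<bullet> (cost_gradient K X *v x) = d \<bullet> (R *v k) + b \<bullet> (X *v a)"
      by (simp only: cost_gradient_def matrix_vector_mult_add_rdistrib inner_add_right)
    have "x \<bullet> ((transpose (A + B ** (K + D)) ** X ** (A + B ** (K + D)) +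
        (M + transpose (K + D) ** R ** (K + D)) - X) *v x)
      = (a + b) \<bullet> (X *v (a + b)) + (x \<bullet> (M *v x) + (k + d) \<bullet> (R *v (k + d))) - x \<bullet> (X *v x)"
      by (simp only: matrix_vector_mult_add_rdistrib[of _ _ x] matrix_vector_mult_diff_rdistrib[of _ _ x]
          inner_add_right[of x] inner_diff_right EE MM[unfolded matrix_vector_mult_add_rdistrib[of _ _ x] inner_add_right[of x]])
    \<comment> \<open>The terms free of \<open>d\<close> and \<open>b\<close> cancel by the value
      equation at \<open>K\<close>; symmetry of \<open>X\<close> and \<open>R\<close> pairs the
      mixed ones.\<close>
    also have "\<dots> = 2 * (d \<bullet> (R *v k) + b \<bullet> (X *v a)) + (d \<bullet> (R *v d) + b \<bullet> (X *v b))"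
      unfolding XX
      by (simp add: matrix_vector_right_distrib inner_add_left inner_add_right symX[of a b] symR[of k d])
    finally show ?thesis using GG by (simp only: defs)
  qed
  then show thesis
    using v cost_trace_identity[OF KD, of M X] by (intro that[of v]) simp_all
qed

lemma cost_value:
  assumes "K \<in> gains" "value_matrix M K X"
  shows "cost M K = trace (X ** W)"
proof -
  have "transpose (A + B ** K) ** X ** (A + B ** K) + (M + transpose K ** R ** K) - X = 0"
    using assms(2) unfolding value_matrix_def by simp
  then show ?thesis
    using cost_trace_identity[OF assms(1), of M X] by (simp add: trace_0[unfolded mat_0] bounded_bilinear.zero_left[OF bounded_bilinear_matrix_mult] trace_def)
qed

text \<open>The covariance of \<open>K\<close> itself certifies stability of nearby gains: its
  Lyapunov residual is \<open>W\<close> at \<open>t = 0\<close> and stays positive definite for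
  small \<open>t\<close>.\<close>

lemma eventually_gains:
  assumes K: "K \<in> gains"
  shows "\<forall>\<^sub>F t in at_right 0. K + t *\<^sub>R D \<in> gains"
proof -
  let ?S = "Sig K" and ?E = "\<lambda>t. A + B ** (K + t *\<^sub>R D)"
  have "((\<lambda>t. ?S - ?E t ** ?S ** transpose (?E t)) \<longlongrightarrow> ?S - ?E 0 ** ?S ** transpose (?E 0)) (at_right 0)"
    by (intro tendsto_intros)
  moreover have "?S - ?E 0 ** ?S ** transpose (?E 0) = W"
    using Sig_eq[OF K] by (simp add: algebra_simps)
  ultimately have lim: "((\<lambda>t. ?S - ?E t ** ?S ** transpose (?E t)) \<longlongrightarrow> W) (at_right 0)"
    by simp
  obtain c where c: "c > 0"
    "\<forall>\<^sub>F t in at_right 0. \<forall>x. c * (norm x)\<^sup>2 \<le> x \<bullet> ((?S - ?E t ** ?S ** transpose (?E t)) *v x)"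
    using eventually_pos_def_bound[OF lim W] by blast
  obtain s where s: "s > 0" "\<And>x. s * (norm x)\<^sup>2 \<le> x \<bullet> (?S *v x)"
    using pos_def_lower_bound[OF Sig_pos_def[OF K]] by blast
  from c(2) show ?thesis
  proof (rule eventually_mono)
    fix t assume t: "\<forall>x. c * (norm x)\<^sup>2 \<le> x \<bullet> ((?S - ?E t ** ?S ** transpose (?E t)) *v x)"
    have "stable (?E t)"
    proof (rule lyapunov_stable[OF _ s c(1)])
      show "?S = ?E t ** ?S ** transpose (?E t) + (?S - ?E t ** ?S ** transpose (?E t))" by simp
    qed (use t in blast)
    then show "K + t *\<^sub>R D \<in> gains" by (simp add: gains_def)
  qed
qed

text \<open>The vectors \<open>v i\<close> span the space, because \<open>Sig K\<close> is onto and
  its values are combinations of them.\<close>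

lemma covariance_kernel:
  fixes G :: "real^'n^'k"
  assumes "K \<in> gains" "\<And>x. Sig K *v x = (\<Sum>i\<in>UNIV. (v i \<bullet> x) *\<^sub>R v i)"
    "\<And>i. G *v v i = 0"
  shows "G = 0"
proof (rule matrix_eqI)
  fix y
  obtain x where "y = Sig K *v x" using pos_def_surj[OF Sig_pos_def[OF assms(1)]] by (metis surjD)
  then have "G *v y = (\<Sum>i\<in>UNIV. (v i \<bullet> x) *\<^sub>R (G *v v i))"
    by (simp only: assms(2) linear_sum[OF matrix_vector_mul_linear] o_def matrix_vector_mult_scaleR)
  then show "G *v y = 0 *v y" by (simp add: assms(3))
qed

text \<open>A small step against a nonzero gradient stays stabilizing and lowers the cost.\<close>

lemma minimizer_gradient_0:
  assumes K: "K \<in> gains" and min: "\<And>K'. K' \<in> gains \<Longrightarrow> cost M K \<le> cost M K'"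
    and X: "value_matrix M K X" and M: "transpose M = M"
  shows "cost_gradient K X = 0"
proof (rule ccontr)
  define G where "G = cost_gradient K X"
  assume "cost_gradient K X \<noteq> 0"
  then have "G \<noteq> 0" by (simp add: G_def)
  define N where "N = R + transpose B ** X ** B"
  have N: "y \<bullet> (N *v y) = y \<bullet> (R *v y) + (B *v y) \<bullet> (X *v (B *v y))" for y
    using inner_congruence[of y "transpose B" X]
    by (simp only: N_def matrix_vector_mult_add_rdistrib inner_add_right transpose_transpose)
  obtain c where c: "c > 0" "\<And>y. y \<bullet> (N *v y) \<le> c * (norm y)\<^sup>2"
    using quadratic_form_upper_bound by blast
  \<comment> \<open>With \<open>t * c < 1\<close> the quadratic term is at most
    \<open>t * (norm (G *v y))\<^sup>2\<close>, half of the decrease from the linear term.\<close>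
  have "\<forall>\<^sub>F t in at_right 0. t < 1 / c"
    using c(1) by (intro order_tendstoD[OF tendsto_ident_at]) auto
  moreover have "\<forall>\<^sub>F t in at_right (0::real). t > 0"
    by (simp add: eventually_at_right_less)
  ultimately have "\<forall>\<^sub>F t in at_right 0. K + t *\<^sub>R (- G) \<in> gains \<and> t < 1 / c \<and> t > 0"
    using eventually_gains[OF K, of "- G"] by eventually_elim simp
  then obtain t where t: "K + t *\<^sub>R (- G) \<in> gains" "t < 1 / c" "t > 0"
    using eventually_happens trivial_limit_at_right_real by blast
  obtain v :: "'n \<Rightarrow> real^'n" where v: "\<And>x. Sig (K + t *\<^sub>R (- G)) *v x = (\<Sum>i\<in>UNIV. (v i \<bullet> x) *\<^sub>R v i)"
    and cost: "cost M (K + t *\<^sub>R (- G)) = trace (X ** W) +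
      (\<Sum>i\<in>UNIV. 2 * (((t *\<^sub>R (- G)) *v v i) \<bullet> (G *v v i)) +
        ((t *\<^sub>R (- G)) *v v i) \<bullet> (N *v ((t *\<^sub>R (- G)) *v v i)))"
    by (rule cost_expansion[OF K t(1) X M, folded G_def N]) (rule that)
  have neg: "2 * (((t *\<^sub>R (- G)) *v y) \<bullet> (G *v y)) + ((t *\<^sub>R (- G)) *v y) \<bullet> (N *v ((t *\<^sub>R (- G)) *v y))
      \<le> - (t * (norm (G *v y))\<^sup>2)" for y
  proof -
    have D: "(t *\<^sub>R (- G)) *v y = - t *\<^sub>R (G *v y)"
      by (simp add: vec_eq_iff matrix_vector_mult_def sum_distrib_left sum_negf mult.assoc)
    have "((t *\<^sub>R (- G)) *v y) \<bullet> (N *v ((t *\<^sub>R (- G)) *v y)) = t\<^sup>2 * ((G *v y) \<bullet> (N *v (G *v y)))"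
      unfolding D by (simp only: matrix_vector_mult_scaleR) (simp add: power2_eq_square)
    also have "\<dots> \<le> t\<^sup>2 * (c * (norm (G *v y))\<^sup>2)" by (intro mult_left_mono c) simp
    also have "\<dots> = t * (t * c) * (norm (G *v y))\<^sup>2" by (simp add: power2_eq_square)
    also have "\<dots> \<le> t * 1 * (norm (G *v y))\<^sup>2"
      using t c(1) by (intro mult_right_mono mult_left_mono) (auto simp: field_simps)
    finally show ?thesis unfolding D by (simp add: power2_norm_eq_inner)
  qed
  have "\<exists>i. G *v v i \<noteq> 0"
    using covariance_kernel[OF t(1) v] \<open>G \<noteq> 0\<close> by blast
  then obtain i where i: "G *v v i \<noteq> 0" by blast
  have "cost M (K + t *\<^sub>R (- G)) \<le> trace (X ** W) + (\<Sum>i\<in>UNIV. - (t * (norm (G *v v i))\<^sup>2))"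
    unfolding cost by (intro add_left_mono sum_mono neg)
  also have "(\<Sum>i\<in>UNIV. - (t * (norm (G *v v i))\<^sup>2)) < 0"
  proof -
    have "0 < (\<Sum>i\<in>UNIV. t * (norm (G *v v i))\<^sup>2)"
      using t(3) i by (intro sum_pos2[of _ i]) auto
    then show ?thesis by (simp add: sum_negf)
  qed
  finally have "cost M (K + t *\<^sub>R (- G)) < cost M K" using cost_value[OF K X] by simp
  with min[OF t(1)] show False by simp
qed

lemma value_matrix_nonneg:
  assumes K: "K \<in> gains" and X: "value_matrix M K X" and M: "\<And>x. 0 \<le> x \<bullet> (M *v x)"
  shows "0 \<le> x \<bullet> (X *v x)"
proof -
  have nonneg: "0 \<le> x \<bullet> ((M + transpose K ** R ** K) *v x)" for x
    unfolding weight_form using M[of x] pos_def_imp_pos_semidef[OF R] by (simp add: pos_semidef_def)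
  have st: "stable (transpose (A + B ** K))" using K by (simp add: gains_def stable_transpose)
  have eq: "X = transpose (A + B ** K) ** X ** transpose (transpose (A + B ** K)) + (M + transpose K ** R ** K)"
    using X by (simp add: value_matrix_def)
  show ?thesis using lyapunov_ge[OF st eq nonneg, of x] nonneg[of x] by linarith
qed

text \<open>The gradient vanishes at \<open>K\<close>, so the excess cost of \<open>K'\<close> is a
  sum of nonnegative terms. If there is no excess, definiteness of \<open>R\<close> makes
  \<open>K' - K\<close> vanish on every \<open>v i\<close>, and these span.\<close>

lemma minimizer_unique:
  assumes K: "K \<in> gains" and min: "\<And>K'. K' \<in> gains \<Longrightarrow> cost M K \<le> cost M K'"
    and K': "K' \<in> gains" "cost M K' \<le> cost M K" and M: "pos_semidef M"
  shows "K' = K"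
proof -
  define D where "D = K' - K"
  have KD: "K + D \<in> gains" using K' by (simp add: D_def)
  have M': "transpose M = M" "\<And>x. 0 \<le> x \<bullet> (M *v x)" using M by (auto simp: pos_semidef_def)
  obtain X where X: "value_matrix M K X" using value_matrix_exists[OF K] by blast
  have G: "cost_gradient K X = 0" by (rule minimizer_gradient_0[OF K min X M'(1)])
  obtain v :: "'n \<Rightarrow> real^'n" where v: "\<And>x. Sig (K + D) *v x = (\<Sum>i\<in>UNIV. (v i \<bullet> x) *\<^sub>R v i)"
    and cost: "cost M (K + D) = trace (X ** W) +
      (\<Sum>i\<in>UNIV. ((D *v v i) \<bullet> (R *v (D *v v i)) + (B *v (D *v v i)) \<bullet> (X *v (B *v (D *v v i)))))"
    by (rule cost_expansion[OF K KD X M'(1)]) (rule that, simp_all add: G)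
  note X0 = value_matrix_nonneg[OF K X M'(2)]
  have R0: "0 \<le> y \<bullet> (R *v y)" for y using pos_def_imp_pos_semidef[OF R] by (simp add: pos_semidef_def)
  have "(\<Sum>i\<in>UNIV. ((D *v v i) \<bullet> (R *v (D *v v i)) + (B *v (D *v v i)) \<bullet> (X *v (B *v (D *v v i))))) \<le> 0"
    using K'(2) cost cost_value[OF K X] by (simp add: D_def)
  then have "(D *v v i) \<bullet> (R *v (D *v v i)) + (B *v (D *v v i)) \<bullet> (X *v (B *v (D *v v i))) \<le> 0" for i
    using member_le_sum[of i UNIV "\<lambda>i. (D *v v i) \<bullet> (R *v (D *v v i)) + (B *v (D *v v i)) \<bullet> (X *v (B *v (D *v v i)))"]
      X0 R0 by (fastforce intro: order_trans add_nonneg_nonneg)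
  then have "(D *v v i) \<bullet> (R *v (D *v v i)) \<le> 0" for i
    using X0[of "B *v (D *v v i)"] by (smt (verit))
  then have "D *v v i = 0" for i using R unfolding pos_def_def by (meson not_less)
  then have "D = 0" by (rule covariance_kernel[OF KD v])
  then show ?thesis by (simp add: D_def)
qed

text \<open>At a common minimizer both gradients vanish, hence so does the linear term in the expansion
  of the difference of the two costs; what remains is nonnegative.\<close>

lemma common_minimizer:
  assumes K: "K \<in> gains"
    and M1: "pos_semidef M1" and min1: "\<And>K'. K' \<in> gains \<Longrightarrow> cost M1 K \<le> cost M1 K'"
    and M2: "pos_semidef M2" and min2: "\<And>K'. K' \<in> gains \<Longrightarrow> cost M2 K \<le> cost M2 K'"
    and le: "\<And>x. x \<bullet> (M1 *v x) \<le> x \<bullet> (M2 *v x)"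
    and K': "K' \<in> gains"
  shows "trace ((M2 - M1) ** Sig K) \<le> trace ((M2 - M1) ** Sig K')"
proof -
  have diff: "trace ((M2 - M1) ** Sig L) = cost M2 L - cost M1 L" for L
    by (simp add: cost_def matrix_mult_add_left trace_add trace_sub
        matrix_mult_diff_left)
  obtain X1 where X1: "value_matrix M1 K X1" using value_matrix_exists[OF K] by blast
  obtain X2 where X2: "value_matrix M2 K X2" using value_matrix_exists[OF K] by blast
  have t1: "transpose M1 = M1" and t2: "transpose M2 = M2" using M1 M2 by (auto simp: pos_semidef_def)
  have g1: "cost_gradient K X1 = 0" by (rule minimizer_gradient_0[OF K min1 X1 t1])
  have g2: "cost_gradient K X2 = 0" by (rule minimizer_gradient_0[OF K min2 X2 t2])
  have st: "stable (transpose (A + B ** K))" using K by (simp add: gains_def stable_transpose)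
  \<comment> \<open>The control costs cancel: the difference is a value matrix for the weight
    \<open>M2 - M1\<close> alone.\<close>
  have eq: "X2 - X1 = transpose (A + B ** K) ** (X2 - X1) ** transpose (transpose (A + B ** K)) + (M2 - M1)"
    by (subst X1[unfolded value_matrix_def], subst X2[unfolded value_matrix_def])
      (simp add: matrix_mult_diff_left matrix_mult_diff_right)
  have le0: "0 \<le> x \<bullet> ((M2 - M1) *v x)" for x
    using le[of x] by (simp add: matrix_vector_mult_diff_rdistrib inner_diff_right)
  have X12: "x \<bullet> (X1 *v x) \<le> x \<bullet> (X2 *v x)" for x
    using lyapunov_ge[OF st eq le0, of x] le0[of x] by (simp add: matrix_vector_mult_diff_rdistrib inner_diff_right)
  have E: "trace ((transpose (A + B ** K') ** (X2 - X1) ** (A + B ** K') + (M2 - M1) - (X2 - X1)) ** Sig K') \<ge> 0"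
  proof (rule trace_nonneg[OF Sig_pos_semidef[OF K']])
    fix x
    let ?Z = "X2 - X1" and ?d = "(K' - K) *v x" and ?a = "(A + B ** K) *v x"
    have symZ: "p \<bullet> (?Z *v q) = q \<bullet> (?Z *v p)" for p q
      using value_matrix_symmetric[OF K X1 t1] value_matrix_symmetric[OF K X2 t2]
      by (metis inner_commute inner_matrix_vector transpose_diff)
    \<comment> \<open>Here \<open>R ** K\<close> cancels as well, leaving exactly the cross term in
      the expansion of the \<open>?Z\<close> form.\<close>
    have "cost_gradient K X2 - cost_gradient K X1 = transpose B ** ?Z ** (A + B ** K)"
      by (simp add: cost_gradient_def matrix_mult_diff_left matrix_mult_diff_right)
    then have "(transpose B ** ?Z ** (A + B ** K)) *v x = 0" using g1 g2 by simp
    then have "transpose B *v (?Z *v ?a) = 0" by (simp only: matrix_vector_mul_assoc matrix_mul_assoc)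
    then have cross: "(B *v ?d) \<bullet> (?Z *v ?a) = 0"
      using inner_matrix_vector[of ?d "transpose B" "?Z *v ?a"] by (simp only: transpose_transpose inner_zero_right)
    have split: "(A + B ** K') *v x = ?a + B *v ?d"
      by (simp add: matrix_vector_mult_add_rdistrib matrix_vector_mult_diff_rdistrib matrix_vector_mul_assoc[symmetric]
         matrix_vector_mult_diff_distrib)
    have "x \<bullet> ((transpose (A + B ** K) ** ?Z ** (A + B ** K)) *v x) = ?a \<bullet> (?Z *v ?a)"
      using inner_congruence[of x "transpose (A + B ** K)" ?Z] unfolding transpose_transpose .
    moreover have "x \<bullet> (?Z *v x) = x \<bullet> ((transpose (A + B ** K) ** ?Z ** (A + B ** K)) *v x)
        + x \<bullet> ((M2 - M1) *v x)"
      by (subst eq[unfolded transpose_transpose]) (simp only: matrix_vector_mult_add_rdistrib inner_add_right)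
    moreover have "x \<bullet> ((transpose (A + B ** K') ** ?Z ** (A + B ** K')) *v x)
        = ?a \<bullet> (?Z *v ?a) + 2 * ((B *v ?d) \<bullet> (?Z *v ?a)) + (B *v ?d) \<bullet> (?Z *v (B *v ?d))"
      using inner_congruence[of x "transpose (A + B ** K')" ?Z] symZ[of ?a "B *v ?d"]
      unfolding transpose_transpose split matrix_vector_right_distrib inner_add_left inner_add_right by linarith
    moreover have "0 \<le> (B *v ?d) \<bullet> (?Z *v (B *v ?d))"
      using X12[of "B *v ?d"] unfolding matrix_vector_mult_diff_rdistrib inner_diff_right by simp
    ultimately show "0 \<le> x \<bullet> ((transpose (A + B ** K') ** ?Z ** (A + B ** K') + (M2 - M1) - ?Z) *v x)"
      using cross unfolding matrix_vector_mult_add_rdistrib[of _ _ x] matrix_vector_mult_diff_rdistrib[of _ ?Z x]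
        inner_add_right[of x] inner_diff_right[of x "_ + _"] by linarith
  qed
  have "cost M2 K' - cost M1 K' = trace ((X2 - X1) ** W) +
    trace ((transpose (A + B ** K') ** (X2 - X1) ** (A + B ** K') + (M2 - M1) - (X2 - X1)) ** Sig K')"
    unfolding cost_trace_identity[OF K', of M2 X2] cost_trace_identity[OF K', of M1 X1]
    by (simp add: matrix_mult_diff_left matrix_mult_diff_right matrix_mult_add_left trace_add trace_sub)
  moreover have "cost M2 K - cost M1 K = trace ((X2 - X1) ** W)"
    by (simp add: cost_value[OF K X2] cost_value[OF K X1] trace_sub
      matrix_mult_diff_left)
  ultimately show ?thesis using E unfolding diff by linarith
qed

section \<open>Coercivity of the cost and compactness of its sublevel sets\<close>

lemma cost_lower_bounds:
  assumes "pos_def M"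
  shows "\<exists>a>0. \<forall>K\<in>gains. a * norm (Sig K) \<le> cost M K \<and> a * (norm K)\<^sup>2 \<le> cost M K"
proof -
  obtain m where m: "m > 0" "\<And>x. m * (norm x)\<^sup>2 \<le> x \<bullet> (M *v x)"
    using pos_def_lower_bound[OF assms] by blast
  obtain r where r: "r > 0" "\<And>x. r * (norm x)\<^sup>2 \<le> x \<bullet> (R *v x)"
    using pos_def_lower_bound[OF R] by blast
  obtain w where w: "w > 0" "\<And>x. w * (norm x)\<^sup>2 \<le> x \<bullet> (W *v x)"
    using pos_def_lower_bound[OF W] by blast
  let ?n = "real CARD('n) ^ 2"
  have n: "?n > 0" by simp
  \<comment> \<open>\<open>m / ?n\<close> comes from the state weight via the trace bound on the
    norm. \<open>r * w\<close> comes from the control cost, since \<open>Sig K\<close> dominates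
    \<open>W\<close>.\<close>
  define a where "a = min (m / ?n) (r * w)"
  have a: "a > 0" using m r w n by (simp add: a_def)
  have "a * norm (Sig K) \<le> cost M K" "a * (norm K)\<^sup>2 \<le> cost M K" if K: "K \<in> gains" for K
  proof -
    note S = Sig_pos_semidef[OF K]
    have r0: "0 \<le> x \<bullet> (R *v x)" for x using pos_def_imp_pos_semidef[OF R] by (simp add: pos_semidef_def)
    have m0: "0 \<le> x \<bullet> (M *v x)" for x using pos_def_imp_pos_semidef[OF assms] by (simp add: pos_semidef_def)
    have "m * trace (Sig K) \<le> cost M K"
      unfolding cost_def
    proof (rule trace_lower_bound[OF S])
      fix x show "m * (norm x)\<^sup>2 \<le> x \<bullet> ((M + transpose K ** R ** K) *v x)"
        unfolding weight_form using m(2)[of x] r0[of "K *v x"] by linarith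
    qed
    moreover have "norm (Sig K) \<le> ?n * trace (Sig K)" by (rule pos_semidef_norm_le_trace[OF S])
    then have "m / ?n * norm (Sig K) \<le> m * trace (Sig K)"
      using m(1) n by (simp add: field_simps)
    moreover have "a * norm (Sig K) \<le> m / ?n * norm (Sig K)" by (intro mult_right_mono) (auto simp: a_def)
    ultimately show "a * norm (Sig K) \<le> cost M K" by linarith
    have gram: "pos_semidef (transpose K ** K)"
      by (simp add: pos_semidef_def matrix_transpose_mul matrix_vector_mul_assoc[symmetric]
          inner_matrix_vector[of _ "transpose K"] del: transpose_matrix_vector)
    \<comment> \<open>The roles in \<open>trace_lower_bound\<close> are swapped: the Gram matrix of
      \<open>K\<close> is the semidefinite factor and \<open>Sig K\<close> supplies the
      form.\<close>
    have "w * (norm K)\<^sup>2 \<le> trace (Sig K ** (transpose K ** K))"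
      unfolding trace_gram[symmetric]
    proof (rule trace_lower_bound[OF gram])
      fix x show "w * (norm x)\<^sup>2 \<le> x \<bullet> (Sig K *v x)"
        using w(2)[of x] Sig_ge_W[OF K, of x] by linarith
    qed
    also have "\<dots> = trace ((transpose K ** K) ** Sig K)" by (rule trace_mul_sym)
    finally have "r * (w * (norm K)\<^sup>2) \<le> r * trace ((transpose K ** K) ** Sig K)"
      using r(1) by (intro mult_left_mono) auto
    also have "\<dots> = trace ((r *\<^sub>R (transpose K ** K)) ** Sig K)"
      by (simp add: scaleR_mult_matrix trace_scaleR)
    also have "\<dots> \<le> cost M K"
      unfolding cost_def
    proof (rule trace_mono[OF S])
      fix x
      have "x \<bullet> ((r *\<^sub>R (transpose K ** K)) *v x) = r * (norm (K *v x))\<^sup>2"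
        by (simp only: scaleR_matrix_vector_assoc[symmetric] matrix_vector_mul_assoc[symmetric] inner_scaleR_right
            inner_matrix_vector[of x "transpose K"] transpose_transpose power2_norm_eq_inner)
      then show "x \<bullet> ((r *\<^sub>R (transpose K ** K)) *v x) \<le> x \<bullet> ((M + transpose K ** R ** K) *v x)"
        unfolding weight_form using r(2)[of "K *v x"] m0[of x] by linarith
    qed
    finally have "r * w * (norm K)\<^sup>2 \<le> cost M K" by (simp add: mult.assoc)
    moreover have "a * (norm K)\<^sup>2 \<le> r * w * (norm K)\<^sup>2" by (intro mult_right_mono) (auto simp: a_def)
    ultimately show "a * (norm K)\<^sup>2 \<le> cost M K" by linarith
  qed
  with a show ?thesis by blast
qed

text \<open>Continuity of \<open>Sig\<close> cannot be invoked at a limit gain not yet known to be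
  stabilizing. Gains and covariances are therefore extracted as pairs and the Lyapunov equation is
  passed to the limit, where it first certifies \<open>L\<close> and then identifies the limit with
  \<open>Sig L\<close>.\<close>

lemma sublevel_sequentially_compact:
  fixes K :: "nat \<Rightarrow> real^'n^'m"
  assumes M: "pos_def M" and K: "\<And>i. K i \<in> gains" "\<And>i. cost M (K i) \<le> c"
  obtains r L where "strict_mono r" "L \<in> gains" "(\<lambda>i. K (r i)) \<longlonglongrightarrow> L"
    "(\<lambda>i. Sig (K (r i))) \<longlonglongrightarrow> Sig L"
proof -
  obtain a where a: "a > 0" "\<And>K. K \<in> gains \<Longrightarrow> a * norm (Sig K) \<le> cost M K"
     "\<And>K. K \<in> gains \<Longrightarrow> a * (norm K)\<^sup>2 \<le> cost M K"
    using cost_lower_bounds[OF M] by blast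
  have "norm (Sig (K i)) \<le> c / a" for i
    using a(1) a(2)[OF K(1), of i] K(2)[of i] by (simp add: field_simps)
  then have b1: "bounded (range (\<lambda>i. Sig (K i)))" by (auto simp: bounded_iff)
  have "norm (K i) \<le> sqrt (c / a)" for i
    using a(1) a(3)[OF K(1), of i] K(2)[of i] by (intro real_le_rsqrt) (simp add: field_simps)
  then have b2: "bounded (range K)" by (auto simp: bounded_iff)
  have "bounded (range (\<lambda>i. (K i, Sig (K i))))"
    by (rule bounded_subset[OF bounded_Times[OF b2 b1]]) auto
  then obtain l r where r: "strict_mono r" "((\<lambda>i. (K i, Sig (K i))) \<circ> r) \<longlonglongrightarrow> l"
    using bounded_imp_convergent_subsequence by blast
  obtain L S where l: "l = (L, S)" by (cases l)
  have KL: "(\<lambda>i. K (r i)) \<longlonglongrightarrow> L" and SL: "(\<lambda>i. Sig (K (r i))) \<longlonglongrightarrow> S"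
    using tendsto_fst[OF r(2)] tendsto_snd[OF r(2)] by (simp_all add: o_def l)
  have lim: "(\<lambda>i. (A + B ** K (r i)) ** Sig (K (r i)) ** transpose (A + B ** K (r i)) + W)
      \<longlonglongrightarrow> (A + B ** L) ** S ** transpose (A + B ** L) + W"
    by (intro tendsto_intros KL SL)
  have "(\<lambda>i. Sig (K (r i))) \<longlonglongrightarrow> (A + B ** L) ** S ** transpose (A + B ** L) + W"
    using lim unfolding Sig_eq[OF K(1), symmetric] .
  then have S: "S = (A + B ** L) ** S ** transpose (A + B ** L) + W"
    using SL LIMSEQ_unique by blast
  obtain w where w: "w > 0" "\<And>x. w * (norm x)\<^sup>2 \<le> x \<bullet> (W *v x)"
    using pos_def_lower_bound[OF W] by blast
  have "w * (norm x)\<^sup>2 \<le> x \<bullet> (S *v x)" for x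
  proof (rule LIMSEQ_le_const)
    show "(\<lambda>i. x \<bullet> (Sig (K (r i)) *v x)) \<longlonglongrightarrow> x \<bullet> (S *v x)" by (intro tendsto_intros SL)
    show "\<exists>N. \<forall>n\<ge>N. w * (norm x)\<^sup>2 \<le> x \<bullet> (Sig (K (r n)) *v x)"
      using w(2)[of x] Sig_ge_W[OF K(1), of x] order_trans by blast
  qed
  then have "stable (A + B ** L)" using lyapunov_stable[OF S w(1) _ w] by blast
  then have L: "L \<in> gains" by (simp add: gains_def)
  have "Sig L = S" by (rule Sig_eqI[OF L S])
  with r(1) L KL SL show thesis by (intro that[of r L]) auto
qed

end

section \<open>Lagrangian duality\<close>

text \<open>The type of gains carries no topology here: \<open>subseq\<close> packages compactness
  of the sublevel sets of \<open>f\<close> with continuity of \<open>f\<close> and \<open>g\<close>.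
  The assumptions \<open>unique\<close> and \<open>common\<close> stand where convexity would
  usually be.\<close>

locale lagrange_duality =
  fixes S :: "'k set" and f g :: "'k \<Rightarrow> real" and b :: real
  assumes subseq: "\<And>(X :: nat \<Rightarrow> 'k) c. (\<And>n. X n \<in> S) \<Longrightarrow> (\<And>n. f (X n) \<le> c) \<Longrightarrow>
      \<exists>r K. strict_mono r \<and> K \<in> S \<and> (\<lambda>n. f (X (r n))) \<longlonglongrightarrow> f K \<and> (\<lambda>n. g (X (r n))) \<longlonglongrightarrow> g K"
    and f_nonneg: "\<And>K. K \<in> S \<Longrightarrow> 0 \<le> f K"
    and g_bound: "\<And>K. K \<in> S \<Longrightarrow> - b \<le> g K"
    and unique: "\<And>l K K'. 0 \<le> l \<Longrightarrow> K \<in> S \<Longrightarrow> (\<And>K''. K'' \<in> S \<Longrightarrow> f K + l * g K \<le> f K'' + l * g K'') \<Longrightarrow>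
      K' \<in> S \<Longrightarrow> f K' + l * g K' \<le> f K + l * g K \<Longrightarrow> K' = K"
    and common: "\<And>l l' K K'. 0 \<le> l \<Longrightarrow> l < l' \<Longrightarrow> K \<in> S \<Longrightarrow>
      (\<And>K''. K'' \<in> S \<Longrightarrow> f K + l * g K \<le> f K'' + l * g K'') \<Longrightarrow>
      (\<And>K''. K'' \<in> S \<Longrightarrow> f K + l' * g K \<le> f K'' + l' * g K'') \<Longrightarrow> K' \<in> S \<Longrightarrow> g K \<le> g K'"
    and slater: "\<exists>K\<in>S. g K < 0"
begin

definition minimizes :: "real \<Rightarrow> 'k \<Rightarrow> bool" where
  "minimizes l K \<longleftrightarrow> K \<in> S \<and> (\<forall>K'\<in>S. f K + l * g K \<le> f K' + l * g K')"

lemma minimizes_unique: "0 \<le> l \<Longrightarrow> minimizes l K \<Longrightarrow> minimizes l K' \<Longrightarrow> K' = K"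
  by (rule unique) (auto simp: minimizes_def)

text \<open>The lower bound on \<open>g\<close> turns a bound on the Lagrangian into one on
  \<open>f\<close> alone, the form that \<open>subseq\<close> asks for.\<close>

lemma f_le: "0 \<le> l \<Longrightarrow> K \<in> S \<Longrightarrow> f K \<le> f K + l * g K + l * b"
  using g_bound[of K] mult_left_mono[of "- b" "g K" l] by simp

text \<open>Serves twice: a fixed multiplier with errors tending to 0 yields existence of
  minimizers, and exact minimizers for moving multipliers yield continuity in the
  multiplier.\<close>

lemma almost_minimizers_converge:
  assumes "\<And>n. X n \<in> S" "\<And>n. 0 \<le> l n" "l \<longlonglongrightarrow> l'" "e \<longlonglongrightarrow> 0"
    and X: "\<And>n K. K \<in> S \<Longrightarrow> f (X n) + l n * g (X n) \<le> f K + l n * g K + e n"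
  shows "\<exists>r K. strict_mono r \<and> minimizes l' K \<and> (\<lambda>n. g (X (r n))) \<longlonglongrightarrow> g K"
proof -
  obtain K0 where K0: "K0 \<in> S" using slater by blast
  have "(\<lambda>n. f K0 + l n * g K0 + e n + l n * b) \<longlonglongrightarrow> f K0 + l' * g K0 + 0 + l' * b"
    by (intro tendsto_intros assms)
  then have "Bseq (\<lambda>n. f K0 + l n * g K0 + e n + l n * b)"
    by (rule convergent_imp_Bseq[OF convergentI])
  then obtain c where c: "\<And>n. norm (f K0 + l n * g K0 + e n + l n * b) \<le> c" by (auto simp: Bseq_def)
  have "f (X n) \<le> c" for n
    using f_le[OF assms(2)[of n] assms(1)[of n]] X[OF K0, of n] c[of n] by simp
  then obtain r K where r: "strict_mono r" and K: "K \<in> S" "(\<lambda>n. f (X (r n))) \<longlonglongrightarrow> f K"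
     "(\<lambda>n. g (X (r n))) \<longlonglongrightarrow> g K"
    using subseq[where X = X and c = c, OF assms(1)] by blast
  have lr: "(\<lambda>n. l (r n)) \<longlonglongrightarrow> l'" "(\<lambda>n. e (r n)) \<longlonglongrightarrow> 0"
    using LIMSEQ_subseq_LIMSEQ[OF assms(3) r] LIMSEQ_subseq_LIMSEQ[OF assms(4) r] by (simp_all add: o_def)
  have "f K + l' * g K \<le> f K' + l' * g K'" if "K' \<in> S" for K'
  proof (rule LIMSEQ_le)
    show "(\<lambda>n. f (X (r n)) + l (r n) * g (X (r n))) \<longlonglongrightarrow> f K + l' * g K"
      by (intro tendsto_intros K lr)
    have "(\<lambda>n. f K' + l (r n) * g K' + e (r n)) \<longlonglongrightarrow> f K' + l' * g K' + 0"
      by (intro tendsto_intros lr)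
    then show "(\<lambda>n. f K' + l (r n) * g K' + e (r n)) \<longlonglongrightarrow> f K' + l' * g K'" by simp
  qed (use X[OF that] in blast)
  with r K show ?thesis by (auto simp: minimizes_def)
qed

lemma minimizer_exists:
  assumes "0 \<le> l" shows "\<exists>K. minimizes l K"
proof -
  let ?h = "\<lambda>K. f K + l * g K"
  have bdd: "bdd_below (?h ` S)"
  proof (rule bdd_belowI2)
    fix K assume "K \<in> S"
    then show "- (l * b) \<le> ?h K" using f_le[OF assms, of K] f_nonneg[of K] by simp
  qed
  have ne: "?h ` S \<noteq> {}" using slater by blast
  have "\<exists>K\<in>S. ?h K < Inf (?h ` S) + inverse (real (Suc n))" for n
    using cInf_less_iff[OF ne bdd, of "Inf (?h ` S) + inverse (real (Suc n))"] by auto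
  then obtain X where X: "\<And>n. X n \<in> S" "\<And>n. ?h (X n) < Inf (?h ` S) + inverse (real (Suc n))"
    by metis
  have "?h (X n) \<le> ?h K + inverse (real (Suc n))" if "K \<in> S" for n K
    using X(2)[of n] cInf_lower[OF imageI[OF that] bdd] by linarith
  from almost_minimizers_converge[of X "\<lambda>_. l", OF X(1) assms tendsto_const LIMSEQ_inverse_real_of_nat this]
  show ?thesis by auto
qed

definition minimizer :: "real \<Rightarrow> 'k" where
  "minimizer l = (SOME K. minimizes l K)"

lemma minimizes_minimizer: "0 \<le> l \<Longrightarrow> minimizes l (minimizer l)"
  unfolding minimizer_def by (rule someI_ex[OF minimizer_exists])

lemma minimizes_iff: "0 \<le> l \<Longrightarrow> minimizes l K \<longleftrightarrow> K = minimizer l"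
  using minimizes_unique minimizes_minimizer by blast

text \<open>Continuity of the constraint value, phrased through closed preimages: some subsequence
  of the minimizers has constraint values converging to that of a minimizer for the limit
  multiplier, and uniqueness says which one it is.\<close>

lemma closed_multipliers:
  assumes "closed C"
  shows "closed {l. 0 \<le> l \<and> g (minimizer l) \<in> C}"
  unfolding closed_sequential_limits
proof (intro allI impI, elim conjE)
  fix l :: "nat \<Rightarrow> real" and l'
  assume l: "\<forall>n. l n \<in> {l. 0 \<le> l \<and> g (minimizer l) \<in> C}" and lim: "l \<longlonglongrightarrow> l'"
  have l0: "\<And>n. 0 \<le> l n" and gC: "\<And>n. g (minimizer (l n)) \<in> C" using l by auto
  have l'0: "0 \<le> l'" using LIMSEQ_le_const[OF lim] l0 by blast
  obtain r K where r: "strict_mono r" "minimizes l' K" "(\<lambda>n. g (minimizer (l (r n)))) \<longlonglongrightarrow> g K"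
    using almost_minimizers_converge[of "\<lambda>n. minimizer (l n)" l l' "\<lambda>_. 0"]
      minimizes_minimizer[OF l0] l0 lim by (auto simp: minimizes_def)
  have "g K \<in> C" using closed_sequentially[OF assms gC r(3)] .
  then show "l' \<in> {l. 0 \<le> l \<and> g (minimizer l) \<in> C}"
    using l'0 minimizes_iff[OF l'0] r(2) by simp
qed

text \<open>Complementary slackness: the multipliers with \<open>g \<ge> 0\<close> and those with \<open>g \<le> 0\<close> at the minimizer
  form two closed sets covering the half-line, so they meet unless the first is empty.\<close>

lemma multiplier_exists: "\<exists>l\<ge>0. g (minimizer l) \<le> 0 \<and> l * g (minimizer l) = 0"
proof (cases "g (minimizer 0) \<le> 0")
  case True
  then show ?thesis by (intro exI[of _ 0]) simp
next
  case False
  obtain K0 where K0: "K0 \<in> S" "g K0 < 0" using slater by blast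
  define U where "U = {l. 0 \<le> l \<and> g (minimizer l) \<in> {0..}}"
  define V where "V = {l. 0 \<le> l \<and> g (minimizer l) \<in> {..0}}"
  have "0 \<in> U" using False by (simp add: U_def)
  \<comment> \<open>Chosen so that the Lagrangian at \<open>K0\<close> is -1; as \<open>f\<close> is
    nonnegative, the minimizer for \<open>m\<close> must have a negative constraint value.\<close>
  define m where "m = (f K0 + 1) / (- g K0)"
  have m0: "0 \<le> m" using K0 f_nonneg[OF K0(1)] unfolding m_def by (intro divide_nonneg_pos) auto
  have "m * g K0 = - (f K0 + 1)" using K0 by (simp add: m_def field_simps)
  moreover have "f (minimizer m) + m * g (minimizer m) \<le> f K0 + m * g K0" "minimizer m \<in> S"
    using minimizes_minimizer[OF m0] K0(1) by (auto simp: minimizes_def)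
  ultimately have "m * g (minimizer m) < 0" using f_nonneg[of "minimizer m"] by linarith
  then have "g (minimizer m) < 0" using m0 by (simp add: mult_less_0_iff)
  then have "m \<in> V" using m0 by (simp add: V_def)
  have "closed U" "closed V" unfolding U_def V_def by (rule closed_multipliers; simp)+
  moreover have "{0..} \<subseteq> U \<union> V" by (auto simp: U_def V_def)
  moreover have "connected {0::real..}" by (rule convex_connected) simp
  ultimately have "U \<inter> V \<inter> {0..} \<noteq> {}"
    using \<open>0 \<in> U\<close> \<open>m \<in> V\<close> m0 unfolding connected_closed by (metis IntI atLeast_iff empty_iff order_refl)
  then obtain l where "l \<in> U" "l \<in> V" by blast
  then show ?thesis by (intro exI[of _ l]) (auto simp: U_def V_def)
qed

lemma minimizer_multiplier_unique:
  assumes l: "0 \<le> l" "minimizes l K" "l * g K = 0" and l': "0 \<le> l'" "minimizes l' K" "l' * g K = 0"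
  shows "l' = l"
proof (rule ccontr)
  assume "l' \<noteq> l"
  \<comment> \<open>Distinct multipliers are not both 0, so slackness at a nonzero one
    applies.\<close>
  then have "g K = 0" using l(3) l'(3) by auto
  obtain K0 where K0: "K0 \<in> S" "g K0 < 0" using slater by blast
  have "g K \<le> g K0"
  proof (cases "l < l'")
    case True
    show ?thesis by (rule common[OF l(1) True _ _ _ K0(1)]) (use l(2) l'(2) in \<open>auto simp: minimizes_def\<close>)
  next
    case False
    then have "l' < l" using \<open>l' \<noteq> l\<close> by simp
    show ?thesis by (rule common[OF l'(1) \<open>l' < l\<close> _ _ _ K0(1)]) (use l(2) l'(2) in \<open>auto simp: minimizes_def\<close>)
  qed
  with K0 \<open>g K = 0\<close> show False by simp
qed

lemma saddle_point:
  obtains l K where "0 \<le> l" "minimizes l K" "g K \<le> 0" "l * g K = 0"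
    "\<And>l'. 0 \<le> l' \<Longrightarrow> f K \<le> f (minimizer l') + l' * g (minimizer l') \<Longrightarrow> l' = l"
proof -
  obtain l where l: "0 \<le> l" "g (minimizer l) \<le> 0" "l * g (minimizer l) = 0"
    using multiplier_exists by blast
  define K where "K = minimizer l"
  note lK = l[folded K_def]
  have K: "minimizes l K" using minimizes_minimizer[OF l(1)] by (simp add: K_def)
  have uniq: "l' = l" if l': "0 \<le> l'" and le: "f K \<le> f (minimizer l') + l' * g (minimizer l')" for l'
  proof -
    have m: "minimizes l' (minimizer l')" by (rule minimizes_minimizer[OF l'])
    \<comment> \<open>The chain from \<open>f K\<close> to the dual value at \<open>l'\<close>, to
      \<open>f K + l' * g K\<close>, and back to at most \<open>f K\<close> collapses to equalities:
      \<open>K\<close> also minimizes at \<open>l'\<close>, with slackness.\<close>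
    have "l' * g K \<le> 0" using l' lK(2) by (simp add: mult_nonneg_nonpos)
    moreover have "f (minimizer l') + l' * g (minimizer l') \<le> f K + l' * g K"
      using m K by (simp add: minimizes_def)
    ultimately have "l' * g K = 0" "f K + l' * g K \<le> f (minimizer l') + l' * g (minimizer l')"
      using le by linarith+
    then have "minimizes l' K"
      using m K unfolding minimizes_def by (meson order_trans)
    with \<open>l' * g K = 0\<close> show ?thesis
      using minimizer_multiplier_unique[OF l(1) K lK(3) l'] by simp
  qed
  show thesis by (rule that[OF l(1) K lK(2,3)]) (rule uniq)
qed

end

section \<open>Strong duality for the risk-constrained LQR problem\<close>

text \<open>Full row rank makes \<open>H\<close> onto, hence its transpose injective, so the
  congruence preserves definiteness.\<close>

lemma noise_cov_pos_def:
  fixes H :: "real^'d^'n"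
  assumes "full_row_rank H" "pos_def (cov_mat P)"
  shows "pos_def (noise_cov H P)"
  unfolding pos_def_def
proof (intro conjI allI impI)
  show "transpose (noise_cov H P) = noise_cov H P"
    using assms(2) by (simp add: noise_cov_def matrix_transpose_mul pos_def_def matrix_mul_assoc)
  fix x :: "real^'n" assume "x \<noteq> 0"
  have surj: "surj ((*v) H)"
    using assms(1) by (simp add: full_row_rank_def full_rank_surjective)
  have "transpose H *v x \<noteq> 0"
  proof
    assume "transpose H *v x = 0"
    moreover obtain y where "x = H *v y" using surj by (metis surjD)
    ultimately have "x \<bullet> x = 0" using inner_matrix_vector[of x H y] by simp
    then show False using \<open>x \<noteq> 0\<close> by simp
  qed
  then show "0 < x \<bullet> (noise_cov H P *v x)"
    using assms(2) unfolding noise_cov_def inner_congruence pos_def_def by blast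
qed

lemma lqr_lagrange_duality:
  fixes A :: "real^'n^'n" and B :: "real^'m^'n" and H :: "real^'d^'n"
  assumes H: "full_row_rank H" and Q: "pos_def Q" and R: "pos_def R" and Qc: "pos_semidef Qc"
    and cov: "pos_def (cov_mat P)"
    and slater: "\<exists>K\<in>stab_gains A B. risk A B H P Qc K < \<beta>"
  shows "lagrange_duality (stab_gains A B) (lqr_cost A B H P Q R)
    (\<lambda>K. risk A B H P Qc K - \<beta>) (\<beta> - fourth_moment_term H P Qc)"
proof -
  define W where "W = noise_cov H P"
  have W: "pos_def W" using noise_cov_pos_def[OF H cov] by (simp add: W_def)
  interpret lqr A W B R by unfold_locales (rule W, rule R)
  have S: "stab_gains A B = gains"
    by (simp add: stab_gains_def gains_def closed_loop_def spec_radius_less_1_iff)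
  \<comment> \<open>\<open>stationary_cov\<close> selects among positive definite solutions,
    \<open>Sig\<close> among all; there is just one solution and it is positive definite.\<close>
  have cov: "stationary_cov A B H P K = Sig K" if "K \<in> gains" for K
    unfolding stationary_cov_def closed_loop_def W_def[symmetric]
  proof (rule the_equality)
    show "pos_def (Sig K) \<and> Sig K = (A + B ** K) ** Sig K ** transpose (A + B ** K) + W"
      using Sig_pos_def[OF that] Sig_eq[OF that] by blast
  qed (use Sig_eqI[OF that] in auto)
  define C where "C = 4 *\<^sub>R (Qc ** W ** Qc)"
  \<comment> \<open>The risk is linear in \<open>Sig K - W\<close>; the part with \<open>W\<close>
    is independent of the gain and is moved here.\<close>
  define k where "k = fourth_moment_term H P Qc - \<beta> - trace (C ** W)"
  have Qt: "transpose Qc = Qc" using Qc by (simp add: pos_semidef_def)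
  have C: "pos_semidef C"
    unfolding pos_semidef_def
  proof (intro conjI allI)
    show "transpose C = C"
      using W by (simp add: C_def transpose_scalar matrix_transpose_mul Qt pos_def_def matrix_mul_assoc)
    fix x
    have "x \<bullet> (C *v x) = 4 * ((Qc *v x) \<bullet> (W *v (Qc *v x)))"
      using inner_congruence[of x Qc W] unfolding Qt
      by (simp add: C_def scaleR_matrix_vector_assoc[symmetric])
    then show "0 \<le> x \<bullet> (C *v x)" using pos_def_imp_pos_semidef[OF W] by (simp add: pos_semidef_def)
  qed
  let ?f = "lqr_cost A B H P Q R" and ?g = "\<lambda>K. risk A B H P Qc K - \<beta>"
  have f: "?f K = cost Q K" if "K \<in> gains" for K
    by (simp add: lqr_cost_def closed_loop_cost_def cost_def cov[OF that])
  have g: "?g K = trace (C ** Sig K) + k" if "K \<in> gains" for K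
    by (simp add: risk_def k_def cov[OF that] W_def[symmetric] C_def scaleR_mult_matrix trace_scaleR
        matrix_mult_diff_right trace_sub)
  have fg: "?f K + l * ?g K = cost (Q + l *\<^sub>R C) K + l * k" if "K \<in> gains" for K l
    unfolding f[OF that] g[OF that] cost_def
    by (simp add: matrix_mult_add_left trace_add scaleR_mult_matrix trace_scaleR algebra_simps)
  have Ql: "pos_semidef (Q + l *\<^sub>R C)" if "0 \<le> l" for l
    using pos_def_imp_pos_semidef[OF Q] C that
    by (simp add: pos_semidef_def transpose_add transpose_scalar matrix_vector_mult_add_rdistrib
        inner_add_right scaleR_matrix_vector_assoc[symmetric])
  show ?thesis
    unfolding S
  proof
    fix X :: "nat \<Rightarrow> real^'n^'m" and c
    assume X: "\<And>n. X n \<in> gains" and c: "\<And>n. ?f (X n) \<le> c"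
    have "cost Q (X n) \<le> c" for n using c[of n] f[OF X] by simp
    then obtain r L where r: "strict_mono r" and L: "L \<in> gains"
      and lim: "(\<lambda>i. X (r i)) \<longlonglongrightarrow> L" "(\<lambda>i. Sig (X (r i))) \<longlonglongrightarrow> Sig L"
      by (rule sublevel_sequentially_compact[OF Q X]) (rule that)
    have "(\<lambda>n. ?f (X (r n))) \<longlonglongrightarrow> ?f L" unfolding f[OF X] f[OF L] cost_def by (intro tendsto_intros lim)
    moreover have "(\<lambda>n. ?g (X (r n))) \<longlonglongrightarrow> ?g L" unfolding g[OF X] g[OF L] by (intro tendsto_intros lim)
    ultimately show "\<exists>r K. strict_mono r \<and> K \<in> gains \<and> (\<lambda>n. ?f (X (r n))) \<longlonglongrightarrow> ?f K \<and> (\<lambda>n. ?g (X (r n))) \<longlonglongrightarrow> ?g K"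
      using r L by blast
  next
    fix K assume K: "K \<in> gains"
    show "0 \<le> ?f K"
      unfolding f[OF K] cost_def
    proof (rule trace_nonneg[OF Sig_pos_semidef[OF K]])
      fix x show "0 \<le> x \<bullet> ((Q + transpose K ** R ** K) *v x)"
        unfolding weight_form
        using pos_def_imp_pos_semidef[OF Q] pos_def_imp_pos_semidef[OF R] by (simp add: pos_semidef_def)
    qed
    \<comment> \<open>Hence the risk never falls below its fourth moment term, which explains the
      bound handed to the locale.\<close>
    have "pos_semidef (Sig K - W)"
      using Sig_pos_def[OF K] W Sig_ge_W[OF K]
      by (simp add: pos_semidef_def pos_def_def transpose_diff matrix_vector_mult_diff_rdistrib inner_diff_right)
    then have "0 \<le> trace (C ** (Sig K - W))"
      using C by (intro trace_nonneg) (auto simp: pos_semidef_def)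
    then show "- (\<beta> - fourth_moment_term H P Qc) \<le> ?g K"
      unfolding g[OF K] by (simp add: k_def matrix_mult_diff_right trace_sub)
  next
    fix l K K'
    assume l: "0 \<le> l" and K: "K \<in> gains" and min: "\<And>K''. K'' \<in> gains \<Longrightarrow> ?f K + l * ?g K \<le> ?f K'' + l * ?g K''"
      and K': "K' \<in> gains" "?f K' + l * ?g K' \<le> ?f K + l * ?g K"
    show "K' = K"
    proof (rule minimizer_unique[OF K _ K'(1) _ Ql[OF l]])
      show "cost (Q + l *\<^sub>R C) K \<le> cost (Q + l *\<^sub>R C) K''" if "K'' \<in> gains" for K''
        using min[OF that] unfolding fg[OF K] fg[OF that] by simp
      show "cost (Q + l *\<^sub>R C) K' \<le> cost (Q + l *\<^sub>R C) K"
        using K'(2) unfolding fg[OF K] fg[OF K'(1)] by simp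
    qed
  next
    fix l l' K K'
    assume l: "0 \<le> l" "l < l'" and K: "K \<in> gains"
      and min: "\<And>K''. K'' \<in> gains \<Longrightarrow> ?f K + l * ?g K \<le> ?f K'' + l * ?g K''"
      and min': "\<And>K''. K'' \<in> gains \<Longrightarrow> ?f K + l' * ?g K \<le> ?f K'' + l' * ?g K''"
      and K': "K' \<in> gains"
    have l': "0 \<le> l'" using l by simp
    have diff: "(Q + l' *\<^sub>R C) - (Q + l *\<^sub>R C) = (l' - l) *\<^sub>R C" by (simp add: scaleR_diff_left)
    have "trace (((Q + l' *\<^sub>R C) - (Q + l *\<^sub>R C)) ** Sig K) \<le> trace (((Q + l' *\<^sub>R C) - (Q + l *\<^sub>R C)) ** Sig K')"
    proof (rule common_minimizer[OF K Ql[OF l(1)] _ Ql[OF l'] _ _ K'])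
      fix L assume L: "L \<in> gains"
      show "cost (Q + l *\<^sub>R C) K \<le> cost (Q + l *\<^sub>R C) L"
        using min[OF L] unfolding fg[OF K] fg[OF L] by simp
      show "cost (Q + l' *\<^sub>R C) K \<le> cost (Q + l' *\<^sub>R C) L"
        using min'[OF L] unfolding fg[OF K] fg[OF L] by simp
    next
      fix x
      have "0 \<le> x \<bullet> (((l' - l) *\<^sub>R C) *v x)"
        using C l by (simp add: pos_semidef_def scaleR_matrix_vector_assoc[symmetric])
      then show "x \<bullet> ((Q + l *\<^sub>R C) *v x) \<le> x \<bullet> ((Q + l' *\<^sub>R C) *v x)"
        unfolding diff[symmetric] matrix_vector_mult_diff_rdistrib inner_diff_right by simp
    qed
    then show "?g K \<le> ?g K'"
      using l unfolding diff g[OF K] g[OF K'] by (simp add: scaleR_mult_matrix trace_scaleR)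
  next
    show "\<exists>K\<in>gains. ?g K < 0" using slater unfolding S by simp
  qed
qed

text \<open>The first conjunct determines \<open>opt_gain\<close>, a choice among minimizers, at
  every nonnegative multiplier. Equal optimal values alone would leave attainment open; the
  \<open>is_arg_max\<close> and \<open>is_arg_min\<close> clauses supply it along with
  uniqueness.\<close>

theorem proposition4p4:
  fixes A :: "real^'n^'n" and B :: "real^'m^'n" and H :: "real^'d^'n"
    and Q Qc :: "real^'n^'n" and R :: "real^'m^'m"
    and P :: "(real^'d) measure" and \<beta> :: real
  assumes "stabilizable A B" and "full_row_rank H"
    and "pos_def Q" and "pos_def R" and "pos_semidef Qc"
    and "prob_space P" and "sets P = sets borel"
    and "zero_mean P"
    and "\<not> mutually_singular P lborel" and "nontrivial_lebesgue_density P"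
    and "pos_def (cov_mat P)" and "finite_fourth_moment P"
    and "\<exists>K\<in>stab_gains A B. risk A B H P Qc K < \<beta>"
  shows
    "(\<forall>l\<ge>0. \<exists>!K. is_arg_min (\<lambda>K. lagrangian A B H P Q R Qc \<beta> K l) (\<lambda>K. K \<in> stab_gains A B) K) \<and>
     (\<exists>ls.
        (\<forall>l. is_arg_max (dual_fun A B H P Q R Qc \<beta>) (\<lambda>l. l \<ge> 0) l \<longleftrightarrow> l = ls) \<and>
        (\<forall>K. is_arg_min (lqr_cost A B H P Q R) (primal_feasible A B H P Qc \<beta>) K \<longleftrightarrow>
             K = opt_gain A B H P Q R Qc \<beta> ls) \<and>
        (\<forall>K. is_arg_min (max_fun A B H P Q R Qc \<beta>) (\<lambda>K. K \<in> stab_gains A B) K \<longleftrightarrow>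
             K = opt_gain A B H P Q R Qc \<beta> ls) \<and>
        lqr_cost A B H P Q R (opt_gain A B H P Q R Qc \<beta> ls) =
          lagrangian A B H P Q R Qc \<beta> (opt_gain A B H P Q R Qc \<beta> ls) ls \<and>
        (SUP l\<in>{0..}. dual_fun A B H P Q R Qc \<beta> l) =
          ereal (lagrangian A B H P Q R Qc \<beta> (opt_gain A B H P Q R Qc \<beta> ls) ls) \<and>
        ereal (lagrangian A B H P Q R Qc \<beta> (opt_gain A B H P Q R Qc \<beta> ls) ls) =
          (INF K\<in>stab_gains A B. max_fun A B H P Q R Qc \<beta> K))"
proof -
  let ?S = "stab_gains A B" and ?L = "lagrangian A B H P Q R Qc \<beta>" and ?D = "dual_fun A B H P Q R Qc \<beta>"
    and ?f = "lqr_cost A B H P Q R" and ?M = "max_fun A B H P Q R Qc \<beta>"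
    and ?opt = "opt_gain A B H P Q R Qc \<beta>"
  interpret lagrange_duality ?S ?f "\<lambda>K. risk A B H P Qc K - \<beta>" "\<beta> - fourth_moment_term H P Qc"
    using assms by (intro lqr_lagrange_duality)
  have arg: "is_arg_min (\<lambda>K. ?L K l) (\<lambda>K. K \<in> ?S) K \<longleftrightarrow> minimizes l K" for l K
    by (auto simp: is_arg_min_def minimizes_def lagrangian_def not_less)
  \<comment> \<open>Both sides unfold to the same choice term, so no sign condition on
    \<open>l\<close> is needed.\<close>
  have opt: "?opt l = minimizer l" for l
    unfolding opt_gain_def arg_min_def minimizer_def arg ..
  have D: "?D l = ereal (?L (minimizer l) l)" if "0 \<le> l" for l
    unfolding dual_fun_def
  proof (rule antisym)
    have m: "minimizes l (minimizer l)" by (rule minimizes_minimizer[OF that])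
    then show "(INF K\<in>?S. ereal (?L K l)) \<le> ereal (?L (minimizer l) l)"
      by (intro INF_lower) (simp add: minimizes_def)
    show "ereal (?L (minimizer l) l) \<le> (INF K\<in>?S. ereal (?L K l))"
      using m by (intro INF_greatest) (simp add: minimizes_def lagrangian_def)
  qed
  obtain ls Ks where ls: "0 \<le> ls" and Ks: "minimizes ls Ks" "risk A B H P Qc Ks - \<beta> \<le> 0"
      "ls * (risk A B H P Qc Ks - \<beta>) = 0"
    and ls_unique: "\<And>l. 0 \<le> l \<Longrightarrow> ?f Ks \<le> ?f (minimizer l) + l * (risk A B H P Qc (minimizer l) - \<beta>) \<Longrightarrow> l = ls"
    by (rule saddle_point) (rule that)
  have opt_ls: "?opt ls = Ks" using minimizes_iff[OF ls] Ks(1) opt by simp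
  have KsS: "Ks \<in> ?S" using Ks(1) by (simp add: minimizes_def)
  have L_ls: "?L Ks ls = ?f Ks" using Ks(3) by (simp add: lagrangian_def)
  have D_ls: "?D ls = ereal (?f Ks)" using D[OF ls] opt opt_ls L_ls by simp
  have D_le: "?D l \<le> ereal (?f Ks)" if "0 \<le> l" for l
  proof -
    have "?D l \<le> ereal (?L Ks l)" unfolding dual_fun_def by (rule INF_lower[OF KsS])
    also have "?L Ks l \<le> ?f Ks" using that Ks(2) by (simp add: lagrangian_def mult_nonneg_nonpos)
    finally show ?thesis by simp
  qed
  \<comment> \<open>The penalty at \<open>ls\<close> is nonpositive on feasible gains and zero at
    \<open>Ks\<close>. A tie in cost thus makes \<open>K\<close> a minimizer of the Lagrangian at
    \<open>ls\<close>, where uniqueness applies.\<close>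
  have weak: "?f Ks \<le> ?f K" and weak_eq: "?f K \<le> ?f Ks \<Longrightarrow> K = Ks"
    if K: "K \<in> ?S" "risk A B H P Qc K \<le> \<beta>" for K
  proof -
    have "ls * (risk A B H P Qc K - \<beta>) \<le> 0" using ls K(2) by (simp add: mult_nonneg_nonpos)
    then have le: "?f K + ls * (risk A B H P Qc K - \<beta>) \<le> ?f K" by simp
    have "?f Ks + ls * (risk A B H P Qc Ks - \<beta>) \<le> ?f K + ls * (risk A B H P Qc K - \<beta>)"
      using Ks(1) K(1) by (simp add: minimizes_def)
    with le show "?f Ks \<le> ?f K" using Ks(3) by linarith
    assume "?f K \<le> ?f Ks"
    with le Ks(3) have le': "?f K + ls * (risk A B H P Qc K - \<beta>)
        \<le> ?f Ks + ls * (risk A B H P Qc Ks - \<beta>)" by linarith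
    show "K = Ks"
      by (rule unique[OF ls KsS _ K(1) le']) (use Ks(1) in \<open>auto simp: minimizes_def\<close>)
  qed
  have ex1: "\<forall>l\<ge>0. \<exists>!K. is_arg_min (\<lambda>K. ?L K l) (\<lambda>K. K \<in> ?S) K"
    unfolding arg using minimizes_iff by auto
  have max: "is_arg_max ?D (\<lambda>l. l \<ge> 0) l \<longleftrightarrow> l = ls" for l
  proof
    assume l: "is_arg_max ?D (\<lambda>l. l \<ge> 0) l"
    then have l0: "0 \<le> l" by (simp add: is_arg_max_def)
    have "?D ls \<le> ?D l" using l ls by (auto simp: is_arg_max_def not_less)
    then have "?f Ks \<le> ?L (minimizer l) l" unfolding D_ls D[OF l0] by simp
    then show "l = ls" by (intro ls_unique[OF l0]) (simp add: lagrangian_def)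
  next
    assume "l = ls"
    then show "is_arg_max ?D (\<lambda>l. l \<ge> 0) l"
      using ls D_le D_ls by (auto simp: is_arg_max_def not_less)
  qed
  have primal: "is_arg_min ?f (primal_feasible A B H P Qc \<beta>) K \<longleftrightarrow> K = ?opt ls" for K
  proof
    assume K: "is_arg_min ?f (primal_feasible A B H P Qc \<beta>) K"
    then have feas: "K \<in> ?S" "risk A B H P Qc K \<le> \<beta>" by (auto simp: is_arg_min_def primal_feasible_def)
    have "?f K \<le> ?f Ks" using K KsS Ks(2) by (auto simp: is_arg_min_def primal_feasible_def not_less)
    then show "K = ?opt ls" unfolding opt_ls by (rule weak_eq[OF feas])
  next
    assume "K = ?opt ls"
    then show "is_arg_min ?f (primal_feasible A B H P Qc \<beta>) K"
      using weak KsS Ks(2) unfolding opt_ls by (auto simp: is_arg_min_def primal_feasible_def not_less)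
  qed
  have M_Ks: "?M Ks = ereal (?f Ks)" using Ks(2) by (simp add: max_fun_eq)
  have M_ge: "ereal (?f Ks) \<le> ?M K" if "K \<in> ?S" for K
    using weak[OF that] by (simp add: max_fun_eq)
  have minmax: "is_arg_min ?M (\<lambda>K. K \<in> ?S) K \<longleftrightarrow> K = ?opt ls" for K
  proof
    assume K: "is_arg_min ?M (\<lambda>K. K \<in> ?S) K"
    then have KS: "K \<in> ?S" by (simp add: is_arg_min_def)
    have le: "?M K \<le> ereal (?f Ks)" using K KsS M_Ks by (auto simp: is_arg_min_def not_less)
    \<comment> \<open>A finite bound excludes infeasible gains, at which \<open>max_fun\<close> is
      infinite.\<close>
    then have "risk A B H P Qc K \<le> \<beta>" by (simp add: max_fun_eq split: if_splits)
    moreover from this le have "?f K \<le> ?f Ks" by (simp add: max_fun_eq)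
    ultimately show "K = ?opt ls" unfolding opt_ls using KS by (intro weak_eq)
  next
    assume "K = ?opt ls"
    then show "is_arg_min ?M (\<lambda>K. K \<in> ?S) K"
      using KsS M_ge M_Ks unfolding opt_ls by (auto simp: is_arg_min_def not_less)
  qed
  have sup: "(SUP l\<in>{0..}. ?D l) = ereal (?f Ks)"
  proof (rule antisym)
    show "(SUP l\<in>{0..}. ?D l) \<le> ereal (?f Ks)" using D_le by (intro SUP_least) simp
    show "ereal (?f Ks) \<le> (SUP l\<in>{0..}. ?D l)" using ls D_ls by (intro SUP_upper2[of ls]) auto
  qed
  have inf: "ereal (?f Ks) = (INF K\<in>?S. ?M K)"
  proof (rule antisym)
    show "ereal (?f Ks) \<le> (INF K\<in>?S. ?M K)" using M_ge by (intro INF_greatest)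
    show "(INF K\<in>?S. ?M K) \<le> ereal (?f Ks)" unfolding M_Ks[symmetric] by (rule INF_lower[OF KsS])
  qed
  show ?thesis
    by (intro conjI exI[of _ ls] allI ex1 max primal minmax)
      (simp_all add: opt_ls L_ls sup inf)
qed

end
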